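(* Let $\mu\in\mathcal P$, let $\hat{\mathcal H}_{h,\mu}(\mu)\in\mathbb R^{P\times P}$ be the Hessian of $\hat{\mathcal J}_h$ at $\mu$ and $\hat{\mathcal H}_{r,\mu}(\mu)$ the Hessian of the NCD-corrected functional $\hat{\mathcal J}_r$ at $\mu$. Then, with $\|\cdot\|_2$ the spectral norm, $$\big\|\hat{\mathcal H}_{h,\mu}(\mu)-\hat{\mathcal H}_{r,\mu}(\mu)\big\|_2\le\Delta_{\mathcal H}(\mu):=\Big\|\big(\Delta_{\mathcal H_{i,l}}(\mu)\big)_{i,l}\Big\|_2,$$ where, writing $u=u_{r,\mu}$, $p=p_{r,\mu}$, $w=w_{r,\mu}$, $z=z_{r,\mu}$, $d_l=d_{\mu_l}$, $\partial_i=\partial_{\mu_i}$ and omitting the argument $\mu$ of the estimators, $$\begin{aligned}\Delta_{\mathcal H_{i,l}}(\mu):={}&\Delta_{\rm pr}\big(\gamma_{\partial_i\partial_lj_\mu}+2\gamma_{\partial_i\partial_lk_\mu}\|u\|+\gamma_{\partial_i\partial_la_\mu}\|p\|+2\gamma_{\partial_ik_\mu}\|d_lu\|+\gamma_{\partial_ia_\mu}\|d_lp\|\big)\\&+\Delta_{d_{\mu_l}{\rm pr}}\big(\gamma_{\partial_ij_\mu}+2\gamma_{\partial_ik_\mu}\|u\|+\gamma_{\partial_ia_\mu}\|p\|\big)\\&+\Delta_{\rm du}\big(\gamma_{\partial_i\partial_ll_\mu}+\gamma_{\partial_i\partial_la_\mu}\|u\|+\gamma_{\partial_ia_\mu}\|d_lu\|\big)+\Delta_{d_{\mu_l}{\rm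 du}}\big(\gamma_{\partial_il_\mu}+\gamma_{\partial_ia_\mu}\|u\|\big)\\&+\Delta_{\rm pr}^2\gamma_{\partial_i\partial_lk_\mu}+\Delta_{\rm pr}\Delta_{\rm du}\gamma_{\partial_i\partial_la_\mu}+2\Delta_{\rm pr}\Delta_{d_{\mu_l}{\rm pr}}\gamma_{\partial_ik_\mu}+\Delta_{\rm pr}\Delta_{d_{\mu_l}{\rm du}}\gamma_{\partial_ia_\mu}+\Delta_{d_{\mu_l}{\rm pr}}\Delta_{\rm du}\gamma_{\partial_ia_\mu}\\&+\gamma_{\partial_ia_\mu}\|d_lu\|\|w\|+\gamma_{\partial_il_\mu}\|d_lw\|+\gamma_{\partial_ia_\mu}\|u\|\|d_lw\|+2\gamma_{\partial_ik_\mu}\|z\|\|d_lu\|+\gamma_{\partial_ia_\mu}\|z\|\|d_lp\|\\&+\gamma_{\partial_ij_\mu}\|d_lz\|+2\gamma_{\partial_ik_\mu}\|d_lz\|\|u\|+\gamma_{\partial_ia_\mu}\|d_lz\|\|p\|+\gamma_{\partial_i\partial_ll_\mu}\|w\|+\gamma_{\partial_i\partial_la_\mu}\|w\|\|u\|\\&+\gamma_{\partial_i\partial_lj_\mu}\|z\|+2\gamma_{\partial_i\partial_lk_\mu}\|z\|\|u\|+\gamma_{\partial_i\partial_la_\mu}\|z\|\|p\| .\end{aligned}$$ Moreover the auxiliary norms satisfy (i) $\|z\|\le\underline{a_\mu}^{-1}\|r^{\rm pr}_\mu(u)\|$; (ii) $\|w\|\le\underline{a_\mu}^{-1}\big(\|r_\mu^{\rm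 du}(u,p)\|+2\gamma_{k_\mu}\|z\|\big)$; (iii) $\|d_lz\|\le\underline{a_\mu}^{-1}\big(\|r_\mu^{{\rm pr},d_{\mu_l}}(u,d_lu)\|+\gamma_{\partial_la_\mu}\|z\|\big)$; (iv) $\|d_lw\|\le\underline{a_\mu}^{-1}\big(\|r_\mu^{{\rm du},d_{\mu_l}}(u,p,d_lu,d_lp)\|+2\gamma_{k_\mu}\|d_lz\|+2\gamma_{\partial_lk_\mu}\|z\|+\gamma_{\partial_la_\mu}\|w\|\big)$.
   Context: $V$ is a real Hilbert space, $V_h\subset V$ a finite-dimensional subspace with norm $\|\cdot\|$, $\mathcal P=\{\mu\in\mathbb R^P:\mu_{\mathsf a}\le\mu\le\mu_{\mathsf b}\}$ a compact box. For $\mu\in\mathcal P$: $a_\mu$ is a continuous coercive bilinear form on $V$, $l_\mu,j_\mu$ continuous linear functionals, $k_\mu$ a continuous symmetric bilinear form, $\Theta:\mathcal P\to\mathbb R$, $\mathcal J(u,\mu)=\Theta(\mu)+j_\mu(u)+k_\mu(u,u)$. The forms are parameter separable (finite sums of $\mu$-dependent coefficients times parameter-independent continuous (bi)linear forms), and $a_\mu,l_\mu,\mathcal J$ are twice continuously Fréchet differentiable in $\mu$, with locally Lipschitz second derivatives. Norms of functionals/residuals are norms in $V_h'$; $\gamma_b$ denotes the norm (continuity constant) on $V_h$ of a linear functional or bilinear form $b$; $\underline{a_\mu}>0$ is the coercivity constant of $a_\mu$ on $V_h$. $\partial_{\mu_i}$ acts only on the explicit $\mu$-dependence of a form, $d_{\mu_l}$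 is the derivative of the solution maps in direction $e_l$. Residuals: $r^{\rm pr}_\mu(u)[v]=l_\mu(v)-a_\mu(u,v)$, $r^{\rm du}_\mu(u,p)[q]=j_\mu(q)+2k_\mu(q,u)-a_\mu(q,p)$, and $r_\mu^{{\rm pr},d_{\mu_l}}(u,u')[v]=\partial_{\mu_l}r_\mu^{\rm pr}(u)[v]-a_\mu(u',v)$, $r_\mu^{{\rm du},d_{\mu_l}}(u,p,u',p')[v]=\partial_{\mu_l}r_\mu^{\rm du}(u,p)[v]+2k_\mu(v,u')-a_\mu(v,p')$. Full order model: $u_{h,\mu},p_{h,\mu}\in V_h$ solve $r^{\rm pr}_\mu(u_{h,\mu})=0$ and $r^{\rm du}_\mu(u_{h,\mu},p_{h,\mu})=0$ on $V_h$; $\hat{\mathcal J}_h(\mu)=\mathcal J(u_{h,\mu},\mu)$. Reduced model: for subspaces $V_r^{\rm pr},V_r^{\rm du}\subset V_h$, $u_{r,\mu}\in V_r^{\rm pr}$ solves $r^{\rm pr}_\mu(u_{r,\mu})=0$ on $V_r^{\rm pr}$, $p_{r,\mu}\in V_r^{\rm du}$ solves $r^{\rm du}_\mu(u_{r,\mu},p_{r,\mu})=0$ on $V_r^{\rm du}$, and the NCD-corrected functional is $\hat{\mathcal J}_r(\mu)=\mathcal J(u_{r,\mu},\mu)+r^{\rm pr}_\mu(u_{r,\mu})[p_{r,\mu}]$. Sensitivities: $d_{\mu_l}u_{r,\mu}\in V_r^{\rm pr}$ solves $r_\mu^{{\rm pr},d_{\mu_l}}(u_{r,\mu},d_{\mu_l}u_{r,\mu})=0$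 on $V_r^{\rm pr}$ and $d_{\mu_l}p_{r,\mu}\in V_r^{\rm du}$ solves $r_\mu^{{\rm du},d_{\mu_l}}(u_{r,\mu},p_{r,\mu},d_{\mu_l}u_{r,\mu},d_{\mu_l}p_{r,\mu})=0$ on $V_r^{\rm du}$. Auxiliary functions: $z_{r,\mu}\in V_r^{\rm du}$ solves $a_\mu(z_{r,\mu},q)=-r_\mu^{\rm pr}(u_{r,\mu})[q]$ for all $q\in V_r^{\rm du}$; $w_{r,\mu}\in V_r^{\rm pr}$ solves $a_\mu(v,w_{r,\mu})=r_\mu^{\rm du}(u_{r,\mu},p_{r,\mu})[v]-2k_\mu(z_{r,\mu},v)$ for all $v\in V_r^{\rm pr}$; $d_{\mu_l}z_{r,\mu}\in V_r^{\rm du}$ and $d_{\mu_l}w_{r,\mu}\in V_r^{\rm pr}$ are their derivatives in direction $e_l$, i.e. for all $q\in V_r^{\rm du}$, $v\in V_r^{\rm pr}$, $a_\mu(d_{\mu_l}z_{r,\mu},q)=-\partial_{\mu_l}\big(r_\mu^{\rm pr}(u_{r,\mu})[q]+a_\mu(z_{r,\mu},q)\big)+a_\mu(d_{\mu_l}u_{r,\mu},q)$, $a_\mu(v,d_{\mu_l}w_{r,\mu})=\partial_{\mu_l}\big(r_\mu^{\rm du}(u_{r,\mu},p_{r,\mu})[v]-2k_\mu(z_{r,\mu},v)-a_\mu(v,w_{r,\mu})\big)+2k_\mu(v,d_{\mu_l}u_{r,\mu}-d_{\mu_l}z_{r,\mu})-a_\mu(v,d_{\mu_l}p_{r,\mu})$.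 Error estimators: $\Delta_{\rm pr}(\mu)=\underline{a_\mu}^{-1}\|r_\mu^{\rm pr}(u_{r,\mu})\|$, $\Delta_{\rm du}(\mu)=\underline{a_\mu}^{-1}\big(2\gamma_{k_\mu}\Delta_{\rm pr}(\mu)+\|r_\mu^{\rm du}(u_{r,\mu},p_{r,\mu})\|\big)$, $\Delta_{d_{\mu_l}{\rm pr}}(\mu)=\underline{a_\mu}^{-1}\big(\gamma_{\partial_{\mu_l}a_\mu}\Delta_{\rm pr}(\mu)+\|r_\mu^{{\rm pr},d_{\mu_l}}(u_{r,\mu},d_{\mu_l}u_{r,\mu})\|\big)$, $\Delta_{d_{\mu_l}{\rm du}}(\mu)=\underline{a_\mu}^{-1}\big(2\gamma_{\partial_{\mu_l}k_\mu}\Delta_{\rm pr}(\mu)+\gamma_{\partial_{\mu_l}a_\mu}\Delta_{\rm du}(\mu)+2\gamma_{k_\mu}\Delta_{d_{\mu_l}{\rm pr}}(\mu)+\|r_\mu^{{\rm du},d_{\mu_l}}(u_{r,\mu},p_{r,\mu},d_{\mu_l}u_{r,\mu},d_{\mu_l}p_{r,\mu})\|\big)$. *)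

theory Defs
  imports "HOL-Analysis.Analysis"
begin

section \<open>Differentiation and norms\<close>

text \<open>Derivatives are taken relative to a set \<open>S\<close>, so that they are one-sided at boundary points
  of the parameter box.\<close>

definition pdiff :: "(real^'p) set \<Rightarrow> 'p \<Rightarrow> (real^'p \<Rightarrow> real) \<Rightarrow> real^'p \<Rightarrow> real" where
  "pdiff S i f x =
     vector_derivative (\<lambda>t. f (x + t *\<^sub>R axis i 1)) (at 0 within {t. x + t *\<^sub>R axis i 1 \<in> S})"

text \<open>The direction \<open>i\<close> is differentiated first, so that row \<open>i\<close> of the Hessian is the derivative
  of the \<open>i\<close>-th gradient component. The order is immaterial for the \<open>C\<^sup>2\<close> functions considered.\<close>

definition pdiff2 :: "(real^'p) set \<Rightarrow> 'p \<Rightarrow> 'p \<Rightarrow> (real^'p \<Rightarrow> real) \<Rightarrow> real^'p \<Rightarrow> real" where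
  "pdiff2 S i l f = pdiff S l (pdiff S i f)"

definition hessian :: "(real^'p) set \<Rightarrow> (real^'p \<Rightarrow> real) \<Rightarrow> real^'p \<Rightarrow> real^'p^'p" where
  "hessian S f x = (\<chi> i l. pdiff2 S i l f x)"

definition spectral_norm :: "real^'p^'p \<Rightarrow> real" where
  "spectral_norm A = onorm ((*v) A)"

definition C2_loc_Lipschitz_on ::
    "'a::real_normed_vector set \<Rightarrow> ('a \<Rightarrow> 'b::real_normed_vector) \<Rightarrow> bool" where
  "C2_loc_Lipschitz_on S f \<longleftrightarrow>
     (\<exists>(f' :: 'a \<Rightarrow> 'a \<Rightarrow>\<^sub>L 'b) (f'' :: 'a \<Rightarrow> 'a \<Rightarrow>\<^sub>L 'a \<Rightarrow>\<^sub>L 'b).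
        (\<forall>x\<in>S. (f has_derivative blinfun_apply (f' x)) (at x within S)) \<and>
        (\<forall>x\<in>S. (f' has_derivative blinfun_apply (f'' x)) (at x within S)) \<and>
        continuous_on S f'' \<and>
        (\<forall>x\<in>S. \<exists>e>0. \<exists>L. L-lipschitz_on (S \<inter> ball x e) f''))"

definition param_separable :: "'m set \<Rightarrow> ('m \<Rightarrow> 'b::real_vector) \<Rightarrow> bool" where
  "param_separable S b \<longleftrightarrow>
     (\<exists>(Q::nat) (\<theta> :: nat \<Rightarrow> 'm \<Rightarrow> real) (\<beta> :: nat \<Rightarrow> 'b).
        \<forall>\<mu>\<in>S. b \<mu> = (\<Sum>q<Q. \<theta> q \<mu> *\<^sub>R \<beta> q))"

text \<open>Norms on a subspace \<open>W\<close>; as in \<^const>\<open>onorm\<close>, the convention \<open>x / 0 = 0\<close> makes zero vectors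
  harmless.\<close>

definition fun_norm :: "'v::real_normed_vector set \<Rightarrow> ('v \<Rightarrow> real) \<Rightarrow> real" where
  "fun_norm W f = (SUP v\<in>W. \<bar>f v\<bar> / norm v)"

definition bil_norm :: "'v::real_normed_vector set \<Rightarrow> ('v \<Rightarrow> 'v \<Rightarrow> real) \<Rightarrow> real" where
  "bil_norm W b = (SUP (u, v)\<in>W \<times> W. \<bar>b u v\<bar> / (norm u * norm v))"

definition coercivity_const :: "'v::real_normed_vector set \<Rightarrow> ('v \<Rightarrow> 'v \<Rightarrow> real) \<Rightarrow> real" where
  "coercivity_const W b = (INF v\<in>W - {0}. b v v / (norm v)\<^sup>2)"

definition coercive :: "('v::real_normed_vector \<Rightarrow> 'v \<Rightarrow> real) \<Rightarrow> bool" where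
  "coercive b \<longleftrightarrow> (\<exists>\<alpha>>0. \<forall>v. b v v \<ge> \<alpha> * (norm v)\<^sup>2)"

text \<open>The element \<open>u\<close> of \<open>W\<close> satisfying the equation \<open>E u v\<close> for all test vectors \<open>v\<close> in \<open>W\<close>.\<close>

definition solution_in :: "'v set \<Rightarrow> ('v \<Rightarrow> 'v \<Rightarrow> bool) \<Rightarrow> 'v" where
  "solution_in W E = (THE u. u \<in> W \<and> (\<forall>v\<in>W. E u v))"


section \<open>Problem data\<close>

text \<open>Continuous functionals and bilinear forms are represented as bounded linear maps. All values
  at parameters outside the box are irrelevant.\<close>

record (overloaded) ('v, 'p) problem =
  mu_a :: "real^'p"
  mu_b :: "real^'p"
  Vh :: "'v::real_normed_vector set"
  Vpr :: "'v set"
  Vdu :: "'v set"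
  fa :: "real^'p \<Rightarrow> 'v \<Rightarrow>\<^sub>L 'v \<Rightarrow>\<^sub>L real"
  fl :: "real^'p \<Rightarrow> 'v \<Rightarrow>\<^sub>L real"
  fj :: "real^'p \<Rightarrow> 'v \<Rightarrow>\<^sub>L real"
  fk :: "real^'p \<Rightarrow> 'v \<Rightarrow>\<^sub>L 'v \<Rightarrow>\<^sub>L real"
  Theta :: "real^'p \<Rightarrow> real"

definition params :: "('v::real_normed_vector, 'p::finite) problem \<Rightarrow> (real^'p) set" where
  "params M = {\<mu>. \<forall>i. mu_a M $ i \<le> \<mu> $ i \<and> \<mu> $ i \<le> mu_b M $ i}"

definition objective ::
    "('v::real_normed_vector, 'p::finite) problem \<Rightarrow> 'v \<Rightarrow> real^'p \<Rightarrow> real" where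
  "objective M u \<mu> = Theta M \<mu> + fj M \<mu> u + fk M \<mu> u u"


section \<open>Residuals\<close>

context
  fixes M :: "('v::real_normed_vector, 'p::finite) problem"
begin

definition res_pr :: "real^'p \<Rightarrow> 'v \<Rightarrow> 'v \<Rightarrow> real" where
  "res_pr \<mu> u v = fl M \<mu> v - fa M \<mu> u v"

definition res_du :: "real^'p \<Rightarrow> 'v \<Rightarrow> 'v \<Rightarrow> 'v \<Rightarrow> real" where
  "res_du \<mu> u p q = fj M \<mu> q + 2 * fk M \<mu> q u - fa M \<mu> q p"

definition res_pr_d :: "'p \<Rightarrow> real^'p \<Rightarrow> 'v \<Rightarrow> 'v \<Rightarrow> 'v \<Rightarrow> real" where
  "res_pr_d l \<mu> u u' v = pdiff (params M) l (\<lambda>m. res_pr m u v) \<mu> - fa M \<mu> u' v"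

definition res_du_d :: "'p \<Rightarrow> real^'p \<Rightarrow> 'v \<Rightarrow> 'v \<Rightarrow> 'v \<Rightarrow> 'v \<Rightarrow> 'v \<Rightarrow> real" where
  "res_du_d l \<mu> u p u' p' v =
     pdiff (params M) l (\<lambda>m. res_du m u p v) \<mu> + 2 * fk M \<mu> v u' - fa M \<mu> v p'"


section \<open>Full and reduced order models\<close>

definition u_h :: "real^'p \<Rightarrow> 'v" where
  "u_h \<mu> = solution_in (Vh M) (\<lambda>u v. res_pr \<mu> u v = 0)"

definition J_h :: "real^'p \<Rightarrow> real" where
  "J_h \<mu> = objective M (u_h \<mu>) \<mu>"

definition u_r :: "real^'p \<Rightarrow> 'v" where
  "u_r \<mu> = solution_in (Vpr M) (\<lambda>u v. res_pr \<mu> u v = 0)"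

definition p_r :: "real^'p \<Rightarrow> 'v" where
  "p_r \<mu> = solution_in (Vdu M) (\<lambda>p q. res_du \<mu> (u_r \<mu>) p q = 0)"

definition J_r :: "real^'p \<Rightarrow> real" where
  "J_r \<mu> = objective M (u_r \<mu>) \<mu> + res_pr \<mu> (u_r \<mu>) (p_r \<mu>)"

definition d_u_r :: "'p \<Rightarrow> real^'p \<Rightarrow> 'v" where
  "d_u_r l \<mu> = solution_in (Vpr M) (\<lambda>u' v. res_pr_d l \<mu> (u_r \<mu>) u' v = 0)"

definition d_p_r :: "'p \<Rightarrow> real^'p \<Rightarrow> 'v" where
  "d_p_r l \<mu> =
     solution_in (Vdu M) (\<lambda>p' v. res_du_d l \<mu> (u_r \<mu>) (p_r \<mu>) (d_u_r l \<mu>) p' v = 0)"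

definition z_r :: "real^'p \<Rightarrow> 'v" where
  "z_r \<mu> = solution_in (Vdu M) (\<lambda>z q. fa M \<mu> z q = - res_pr \<mu> (u_r \<mu>) q)"

definition w_r :: "real^'p \<Rightarrow> 'v" where
  "w_r \<mu> = solution_in (Vpr M)
     (\<lambda>w v. fa M \<mu> v w = res_du \<mu> (u_r \<mu>) (p_r \<mu>) v - 2 * fk M \<mu> (z_r \<mu>) v)"

definition d_z_r :: "'p \<Rightarrow> real^'p \<Rightarrow> 'v" where
  "d_z_r l \<mu> = solution_in (Vdu M)
     (\<lambda>z' q. fa M \<mu> z' q =
        - pdiff (params M) l (\<lambda>m. res_pr m (u_r \<mu>) q + fa M m (z_r \<mu>) q) \<mu>
        + fa M \<mu> (d_u_r l \<mu>) q)"

definition d_w_r :: "'p \<Rightarrow> real^'p \<Rightarrow> 'v" where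
  "d_w_r l \<mu> = solution_in (Vpr M)
     (\<lambda>w' v. fa M \<mu> v w' =
        pdiff (params M) l
          (\<lambda>m. res_du m (u_r \<mu>) (p_r \<mu>) v - 2 * fk M m (z_r \<mu>) v - fa M m v (w_r \<mu>)) \<mu>
        + 2 * fk M \<mu> v (d_u_r l \<mu> - d_z_r l \<mu>) - fa M \<mu> v (d_p_r l \<mu>))"


section \<open>Constants and error estimators\<close>

definition coer_a :: "real^'p \<Rightarrow> real" where
  "coer_a \<mu> = coercivity_const (Vh M) (\<lambda>u v. fa M \<mu> u v)"

definition gam_k :: "real^'p \<Rightarrow> real" where
  "gam_k \<mu> = bil_norm (Vh M) (\<lambda>u v. fk M \<mu> u v)"

definition gam_d_a :: "'p \<Rightarrow> real^'p \<Rightarrow> real" where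
  "gam_d_a i \<mu> = bil_norm (Vh M) (\<lambda>u v. pdiff (params M) i (\<lambda>m. fa M m u v) \<mu>)"

definition gam_d_k :: "'p \<Rightarrow> real^'p \<Rightarrow> real" where
  "gam_d_k i \<mu> = bil_norm (Vh M) (\<lambda>u v. pdiff (params M) i (\<lambda>m. fk M m u v) \<mu>)"

definition gam_d_l :: "'p \<Rightarrow> real^'p \<Rightarrow> real" where
  "gam_d_l i \<mu> = fun_norm (Vh M) (\<lambda>v. pdiff (params M) i (\<lambda>m. fl M m v) \<mu>)"

definition gam_d_j :: "'p \<Rightarrow> real^'p \<Rightarrow> real" where
  "gam_d_j i \<mu> = fun_norm (Vh M) (\<lambda>v. pdiff (params M) i (\<lambda>m. fj M m v) \<mu>)"

definition gam_dd_a :: "'p \<Rightarrow> 'p \<Rightarrow> real^'p \<Rightarrow> real" where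
  "gam_dd_a i l \<mu> = bil_norm (Vh M) (\<lambda>u v. pdiff2 (params M) i l (\<lambda>m. fa M m u v) \<mu>)"

definition gam_dd_k :: "'p \<Rightarrow> 'p \<Rightarrow> real^'p \<Rightarrow> real" where
  "gam_dd_k i l \<mu> = bil_norm (Vh M) (\<lambda>u v. pdiff2 (params M) i l (\<lambda>m. fk M m u v) \<mu>)"

definition gam_dd_l :: "'p \<Rightarrow> 'p \<Rightarrow> real^'p \<Rightarrow> real" where
  "gam_dd_l i l \<mu> = fun_norm (Vh M) (\<lambda>v. pdiff2 (params M) i l (\<lambda>m. fl M m v) \<mu>)"

definition gam_dd_j :: "'p \<Rightarrow> 'p \<Rightarrow> real^'p \<Rightarrow> real" where
  "gam_dd_j i l \<mu> = fun_norm (Vh M) (\<lambda>v. pdiff2 (params M) i l (\<lambda>m. fj M m v) \<mu>)"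

definition norm_res_pr :: "real^'p \<Rightarrow> real" where
  "norm_res_pr \<mu> = fun_norm (Vh M) (res_pr \<mu> (u_r \<mu>))"

definition norm_res_du :: "real^'p \<Rightarrow> real" where
  "norm_res_du \<mu> = fun_norm (Vh M) (res_du \<mu> (u_r \<mu>) (p_r \<mu>))"

definition norm_res_pr_d :: "'p \<Rightarrow> real^'p \<Rightarrow> real" where
  "norm_res_pr_d l \<mu> = fun_norm (Vh M) (res_pr_d l \<mu> (u_r \<mu>) (d_u_r l \<mu>))"

definition norm_res_du_d :: "'p \<Rightarrow> real^'p \<Rightarrow> real" where
  "norm_res_du_d l \<mu> =
     fun_norm (Vh M) (res_du_d l \<mu> (u_r \<mu>) (p_r \<mu>) (d_u_r l \<mu>) (d_p_r l \<mu>))"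

definition Delta_pr :: "real^'p \<Rightarrow> real" where
  "Delta_pr \<mu> = inverse (coer_a \<mu>) * norm_res_pr \<mu>"

definition Delta_du :: "real^'p \<Rightarrow> real" where
  "Delta_du \<mu> = inverse (coer_a \<mu>) * (2 * gam_k \<mu> * Delta_pr \<mu> + norm_res_du \<mu>)"

definition Delta_d_pr :: "'p \<Rightarrow> real^'p \<Rightarrow> real" where
  "Delta_d_pr l \<mu> = inverse (coer_a \<mu>) * (gam_d_a l \<mu> * Delta_pr \<mu> + norm_res_pr_d l \<mu>)"

definition Delta_d_du :: "'p \<Rightarrow> real^'p \<Rightarrow> real" where
  "Delta_d_du l \<mu> = inverse (coer_a \<mu>) *
     (2 * gam_d_k l \<mu> * Delta_pr \<mu> + gam_d_a l \<mu> * Delta_du \<mu>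
      + 2 * gam_k \<mu> * Delta_d_pr l \<mu> + norm_res_du_d l \<mu>)"

definition Delta_H_entry :: "'p \<Rightarrow> 'p \<Rightarrow> real^'p \<Rightarrow> real" where
  "Delta_H_entry i l \<mu> =
    (let u = norm (u_r \<mu>); p = norm (p_r \<mu>); w = norm (w_r \<mu>); z = norm (z_r \<mu>);
         du = norm (d_u_r l \<mu>); dp = norm (d_p_r l \<mu>);
         dw = norm (d_w_r l \<mu>); dz = norm (d_z_r l \<mu>);
         \<gamma>a = gam_d_a i \<mu>; \<gamma>k = gam_d_k i \<mu>; \<gamma>l = gam_d_l i \<mu>; \<gamma>j = gam_d_j i \<mu>;
         \<gamma>\<gamma>a = gam_dd_a i l \<mu>; \<gamma>\<gamma>k = gam_dd_k i l \<mu>;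
         \<gamma>\<gamma>l = gam_dd_l i l \<mu>; \<gamma>\<gamma>j = gam_dd_j i l \<mu>;
         Dpr = Delta_pr \<mu>; Ddu = Delta_du \<mu>; Ddpr = Delta_d_pr l \<mu>; Dddu = Delta_d_du l \<mu>
     in Dpr * (\<gamma>\<gamma>j + 2 * \<gamma>\<gamma>k * u + \<gamma>\<gamma>a * p + 2 * \<gamma>k * du + \<gamma>a * dp)
      + Ddpr * (\<gamma>j + 2 * \<gamma>k * u + \<gamma>a * p)
      + Ddu * (\<gamma>\<gamma>l + \<gamma>\<gamma>a * u + \<gamma>a * du)
      + Dddu * (\<gamma>l + \<gamma>a * u)
      + Dpr\<^sup>2 * \<gamma>\<gamma>k + Dpr * Ddu * \<gamma>\<gamma>a + 2 * Dpr * Ddpr * \<gamma>k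
      + Dpr * Dddu * \<gamma>a + Ddpr * Ddu * \<gamma>a
      + \<gamma>a * du * w + \<gamma>l * dw + \<gamma>a * u * dw + 2 * \<gamma>k * z * du + \<gamma>a * z * dp
      + \<gamma>j * dz + 2 * \<gamma>k * dz * u + \<gamma>a * dz * p
      + \<gamma>\<gamma>l * w + \<gamma>\<gamma>a * w * u
      + \<gamma>\<gamma>j * z + 2 * \<gamma>\<gamma>k * z * u + \<gamma>\<gamma>a * z * p)"

definition Delta_H :: "real^'p \<Rightarrow> real" where
  "Delta_H \<mu> = spectral_norm (\<chi> i l. Delta_H_entry i l \<mu>)"

end

end

theory Submission
  imports Defs
begin

text \<open>The gradient of the corrected functional contains \<open>r\<^sup>d\<^sup>u[d\<^sub>i u]\<close> and \<open>r\<^sup>p\<^sup>r[d\<^sub>i p]\<close>. The auxiliary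
  functions \<open>z\<close> and \<open>w\<close> are adjoint variables that remove these sensitivities:
  \<open>d\<^sub>i J\<^sub>r = \<partial>\<^sub>i J(u) + \<partial>\<^sub>i r\<^sup>p\<^sup>r(u)[p + w] - \<partial>\<^sub>i r\<^sup>d\<^sup>u(u, p)[z]\<close>. Differentiating once more gives a Hessian
  formula involving first-order sensitivities only. The full order model is the special case in
  which both reduced spaces equal \<open>V\<^sub>h\<close>, where \<open>z = w = 0\<close>, so one formula covers both Hessians. Their
  difference is multilinear in the errors of \<open>u\<close>, \<open>p\<close> and their sensitivities, plus the terms in \<open>z\<close>
  and \<open>w\<close>; coercivity bounds all of these by residual norms, and the spectral norm is monotone under
  entrywise domination.\<close>

section \<open>Finite-dimensional subspaces\<close>

text \<open>The sensitivities \<open>d_u_r\<close>, \<open>d_p_r\<close>, \<open>d_z_r\<close>,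
  \<open>d_w_r\<close> are given only as solutions of linearised equations; that they are
  derivatives of the solution maps is itself a claim, which rests on a difference-quotient argument
  for Galerkin solutions. Differentiation takes place along coordinate lines cut by the box, hence
  one-sidedly at its boundary, and smoothness of j and k enters only through the objective at fixed
  states. Expansion in an orthonormal basis turns statements about forms at fixed arguments into
  product rules and uniform bounds. The term 2 k(z, v) in the equation of w is there for a
  cancellation. The sensitivity of u contributes r_du[d_i u] = a(d_i u, w) + 2 k(z, d_i u) to the
  gradient, that of p contributes r_pr[d_i p] = - a(z, d_i p), and the equation of d_i p tested with
  z produces 2 k(z, d_i u) once more, now with the opposite sign.\<close>

lemma finite_dim_subspace_subset:
  fixes W :: "'a::real_vector set"
  assumes "finite B" "subspace W" "W \<subseteq> span B"
  shows "\<exists>D. finite D \<and> W = span D"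
proof -
  obtain D where D: "D \<subseteq> W" "independent D" "W \<subseteq> span D"
    using maximal_independent_subset[of W] by blast
  then have "finite D"
    using independent_span_bound[OF \<open>finite B\<close>, of D] assms by blast
  moreover have "span D = W"
    using D assms by (simp add: span_minimal subset_antisym)
  ultimately show ?thesis by blast
qed

text \<open>Coordinates in such a basis are inner products, which are linear and continuous in the
  vector, so derivatives of curves pass to coordinates.\<close>

definition orthonormal_basis :: "'v::real_inner set \<Rightarrow> 'v set \<Rightarrow> bool" where
  "orthonormal_basis C H \<longleftrightarrow>
     finite C \<and> span C = H \<and> (\<forall>c\<in>C. \<forall>d\<in>C. c \<bullet> d = (if c = d then 1 else 0))"

lemma orthonormal_basis_norm: "orthonormal_basis C H \<Longrightarrow> c \<in> C \<Longrightarrow> norm c = 1"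
  by (simp add: orthonormal_basis_def norm_eq_sqrt_inner)

lemma orthonormal_basis_independent:
  assumes "orthonormal_basis C H"
  shows "independent C"
proof (rule pairwise_orthogonal_independent)
  show "pairwise orthogonal C"
    using assms by (simp add: orthonormal_basis_def pairwise_def orthogonal_def)
  show "0 \<notin> C"
    using orthonormal_basis_norm[OF assms, of 0] by auto
qed

lemma orthonormal_basis_expansion:
  assumes "orthonormal_basis C H" "v \<in> H"
  shows "v = (\<Sum>c\<in>C. (v \<bullet> c) *\<^sub>R c)"
proof -
  have "v \<in> span C" using assms by (simp add: orthonormal_basis_def)
  then show ?thesis
  proof (rule span_induct)
    show "subspace {v. v = (\<Sum>c\<in>C. (v \<bullet> c) *\<^sub>R c)}"
      by (auto simp: subspace_def inner_left_distrib scaleR_left_distrib sum.distrib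
          simp flip: scaleR_scaleR scaleR_sum_right)
  next
    fix d assume d: "d \<in> C"
    have "(\<Sum>c\<in>C. (d \<bullet> c) *\<^sub>R c) = (\<Sum>c\<in>C. if d = c then c else 0)"
      using d assms by (intro sum.cong) (auto simp: orthonormal_basis_def)
    also have "\<dots> = d" using assms d by (simp add: orthonormal_basis_def)
    finally show "d = (\<Sum>c\<in>C. (d \<bullet> c) *\<^sub>R c)" by simp
  qed
qed

lemma orthonormal_basis_exists:
  fixes H :: "'v::real_inner set"
  assumes "\<exists>B. finite B \<and> H = span B"
  shows "\<exists>C. orthonormal_basis C H"
proof -
  obtain B where "finite B" "H = span B" using assms by blast
  then obtain D where D: "finite D" "span D = H" "pairwise orthogonal D"
    using basis_orthogonal by metis
  \<comment> \<open>The orthogonal spanning set may contain the zero vector, which cannot be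
    normalised.\<close>
  define C where "C = (\<lambda>d. (1 / norm d) *\<^sub>R d) ` (D - {0})"
  have "span C = span (D - {0})"
    unfolding C_def using D by (intro span_image_scale) auto
  then have span: "span C = H"
    using D by (simp add: span_delete_0)
  have norm: "norm c = 1" if "c \<in> C" for c
    using that by (auto simp: C_def split: if_splits)
  have orth: "c \<bullet> d = (if c = d then 1 else 0)" if "c \<in> C" "d \<in> C" for c d
  proof (cases "c = d")
    case True
    then show ?thesis using norm[OF that(1)] by (simp add: dot_square_norm)
  next
    case False
    obtain d1 d2 where d: "c = (1 / norm d1) *\<^sub>R d1" "d = (1 / norm d2) *\<^sub>R d2" "d1 \<in> D" "d2 \<in> D"
      using \<open>c \<in> C\<close> \<open>d \<in> C\<close> unfolding C_def by blast
    with False have "d1 \<noteq> d2" by auto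
    with D(3) d have "d1 \<bullet> d2 = 0"
      by (simp add: pairwise_def orthogonal_def)
    with False d show ?thesis by simp
  qed
  have "finite C" using D by (simp add: C_def)
  with span orth have "orthonormal_basis C H"
    by (simp add: orthonormal_basis_def)
  then show ?thesis ..
qed

section \<open>Linear and bilinear forms in coordinates\<close>

lemma bilinear_flip: "bilinear b \<Longrightarrow> bilinear (\<lambda>u v. b v u)"
  by (auto simp: bilinear_def)

lemma linear_lincomb:
  "linear f \<Longrightarrow> linear g \<Longrightarrow> linear (\<lambda>v. f v + g v :: real)"
  "linear f \<Longrightarrow> linear g \<Longrightarrow> linear (\<lambda>v. f v - g v :: real)"
  "linear f \<Longrightarrow> linear (\<lambda>v. - f v :: real)"
  "linear f \<Longrightarrow> linear (\<lambda>v. c * f v :: real)"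
  by (auto intro!: linearI simp: linear_add linear_scale algebra_simps)

lemma linear_args: "bilinear b \<Longrightarrow> linear (\<lambda>v. b u v)" "bilinear b \<Longrightarrow> linear (\<lambda>v. b v u)"
  by (auto simp: bilinear_def)

lemma linear_expansion:
  fixes f :: "'v::real_inner \<Rightarrow> real"
  assumes "linear f" "orthonormal_basis C H" "v \<in> H"
  shows "f v = (\<Sum>c\<in>C. (v \<bullet> c) * f c)"
  by (subst orthonormal_basis_expansion[OF assms(2,3)])
    (simp add: linear_sum[OF assms(1)] linear_scale[OF assms(1)])

lemma bilinear_expansion:
  fixes b :: "'v::real_inner \<Rightarrow> 'v \<Rightarrow> real"
  assumes "bilinear b" "orthonormal_basis C H" "u \<in> H" "v \<in> H"
  shows "b u v = (\<Sum>c\<in>C. \<Sum>d\<in>C. ((u \<bullet> c) * (v \<bullet> d)) * b c d)"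
proof -
  have "b u v = (\<Sum>c\<in>C. (u \<bullet> c) * b c v)"
    using assms by (intro linear_expansion) (auto simp: bilinear_def)
  also have "\<dots> = (\<Sum>c\<in>C. (u \<bullet> c) * (\<Sum>d\<in>C. (v \<bullet> d) * b c d))"
    using assms by (intro sum.cong refl arg_cong2[where f = "(*)"] linear_expansion)
      (auto simp: bilinear_def)
  finally show ?thesis by (simp add: sum_distrib_left mult.assoc)
qed

text \<open>The constant is an explicit finite sum over the basis: if the values on the basis tend
  to zero along a family of forms, so does the constant.\<close>

lemma linear_bound_finite_dim:
  fixes f :: "'v::real_inner \<Rightarrow> real"
  assumes "linear f" "orthonormal_basis C H" "v \<in> H"
  shows "\<bar>f v\<bar> \<le> (\<Sum>c\<in>C. \<bar>f c\<bar>) * norm v"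
proof -
  have "\<bar>f v\<bar> \<le> (\<Sum>c\<in>C. \<bar>(v \<bullet> c) * f c\<bar>)"
    by (subst linear_expansion[OF assms]) (rule sum_abs)
  also have "\<dots> \<le> (\<Sum>c\<in>C. norm v * \<bar>f c\<bar>)"
  proof (rule sum_mono)
    fix c assume "c \<in> C"
    then have "\<bar>v \<bullet> c\<bar> \<le> norm v"
      using Cauchy_Schwarz_ineq2[of v c] orthonormal_basis_norm[OF assms(2)] by simp
    then show "\<bar>(v \<bullet> c) * f c\<bar> \<le> norm v * \<bar>f c\<bar>"
      by (simp add: abs_mult mult_right_mono)
  qed
  finally show ?thesis by (simp add: mult.commute flip: sum_distrib_left)
qed

lemma bilinear_bound_finite_dim:
  fixes b :: "'v::real_inner \<Rightarrow> 'v \<Rightarrow> real"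
  assumes "bilinear b" "orthonormal_basis C H" "u \<in> H" "v \<in> H"
  shows "\<bar>b u v\<bar> \<le> (\<Sum>c\<in>C. \<Sum>d\<in>C. \<bar>b c d\<bar>) * (norm u * norm v)"
proof -
  have "\<bar>b u v\<bar> \<le> (\<Sum>c\<in>C. \<bar>b c v\<bar>) * norm u"
    using assms by (intro linear_bound_finite_dim) (auto simp: bilinear_def)
  also have "\<dots> \<le> (\<Sum>c\<in>C. (\<Sum>d\<in>C. \<bar>b c d\<bar>) * norm v) * norm u"
    using assms by (intro mult_right_mono sum_mono linear_bound_finite_dim)
      (auto simp: bilinear_def)
  also have "\<dots> = (\<Sum>c\<in>C. \<Sum>d\<in>C. \<bar>b c d\<bar>) * (norm u * norm v)"
    by (simp flip: sum_distrib_right)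
  finally show ?thesis .
qed

section \<open>Dual norms, continuity constants and coercivity constants\<close>

lemma fun_norm_bound:
  fixes f :: "'v::real_inner \<Rightarrow> real"
  assumes "\<exists>B. finite B \<and> H = span B" "linear f" "v \<in> H"
  shows "\<bar>f v\<bar> \<le> fun_norm H f * norm v"
proof -
  obtain C where C: "orthonormal_basis C H"
    using orthonormal_basis_exists[OF assms(1)] ..
  have "bdd_above ((\<lambda>v. \<bar>f v\<bar> / norm v) ` H)"
  proof (rule bdd_aboveI2)
    fix v assume "v \<in> H"
    then show "\<bar>f v\<bar> / norm v \<le> (\<Sum>c\<in>C. \<bar>f c\<bar>)"
      using linear_bound_finite_dim[OF assms(2) C, of v]
      by (cases "v = 0") (simp_all add: divide_le_eq sum_nonneg)
  qed
  then have "\<bar>f v\<bar> / norm v \<le> fun_norm H f"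
    unfolding fun_norm_def using assms(3) by (intro cSUP_upper)
  then show ?thesis
    using assms(2) by (cases "v = 0") (simp_all add: divide_le_eq linear_0)
qed

lemma bil_norm_bound:
  fixes b :: "'v::real_inner \<Rightarrow> 'v \<Rightarrow> real"
  assumes "\<exists>B. finite B \<and> H = span B" "bilinear b" "u \<in> H" "v \<in> H"
  shows "\<bar>b u v\<bar> \<le> bil_norm H b * (norm u * norm v)"
proof -
  obtain C where C: "orthonormal_basis C H"
    using orthonormal_basis_exists[OF assms(1)] ..
  have "bdd_above ((\<lambda>(u, v). \<bar>b u v\<bar> / (norm u * norm v)) ` (H \<times> H))"
  proof (rule bdd_aboveI2)
    fix x assume "x \<in> H \<times> H"
    then obtain u v where x: "x = (u, v)" "u \<in> H" "v \<in> H" by auto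
    then show "(case x of (u, v) \<Rightarrow> \<bar>b u v\<bar> / (norm u * norm v)) \<le> (\<Sum>c\<in>C. \<Sum>d\<in>C. \<bar>b c d\<bar>)"
      using bilinear_bound_finite_dim[OF assms(2) C, of u v]
      by (cases "u = 0 \<or> v = 0") (auto simp: divide_le_eq sum_nonneg)
  qed
  then have "(case (u, v) of (u, v) \<Rightarrow> \<bar>b u v\<bar> / (norm u * norm v)) \<le> bil_norm H b"
    unfolding bil_norm_def using assms by (intro cSUP_upper) auto
  then show ?thesis
    using assms(2) by (cases "u = 0 \<or> v = 0") (auto simp: divide_le_eq bilinear_lzero bilinear_rzero)
qed

text \<open>A nonzero vector forces the sign through the bound; on \<open>{0}\<close> the supremum
  is over the single quotient \<open>0 / 0 = 0\<close>.\<close>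

lemma fun_norm_nonneg:
  fixes f :: "'v::real_inner \<Rightarrow> real"
  assumes "\<exists>B. finite B \<and> H = span B" "linear f"
  shows "0 \<le> fun_norm H f"
proof (cases "H \<subseteq> {0}")
  case True
  moreover have "0 \<in> H" using assms(1) by (auto simp: span_zero)
  ultimately have "H = {0}" by auto
  then show ?thesis by (simp add: fun_norm_def)
next
  case False
  then obtain v where "v \<in> H" "v \<noteq> 0" by auto
  then have "0 \<le> fun_norm H f * norm v"
    using fun_norm_bound[OF assms] by (meson abs_ge_zero order_trans)
  then show ?thesis using \<open>v \<noteq> 0\<close> by (simp add: zero_le_mult_iff)
qed

lemma bil_norm_nonneg:
  fixes b :: "'v::real_inner \<Rightarrow> 'v \<Rightarrow> real"
  assumes "\<exists>B. finite B \<and> H = span B" "bilinear b"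
  shows "0 \<le> bil_norm H b"
proof (cases "H \<subseteq> {0}")
  case True
  moreover have "0 \<in> H" using assms(1) by (auto simp: span_zero)
  ultimately have "H = {0}" by auto
  then show ?thesis by (simp add: bil_norm_def)
next
  case False
  then obtain v where "v \<in> H" "v \<noteq> 0" by auto
  then have "0 \<le> bil_norm H b * (norm v * norm v)"
    using bil_norm_bound[OF assms] by (meson abs_ge_zero order_trans)
  moreover have "0 < norm v * norm v" using \<open>v \<noteq> 0\<close> by simp
  ultimately show ?thesis by (simp add: zero_le_mult_iff not_le[symmetric])
qed

text \<open>With a majorant \<open>B\<close> in place of the norm, error norms can later be
  exchanged for estimators in the same step.\<close>

lemma fun_norm_le:
  fixes f :: "'v::real_inner \<Rightarrow> real"
  assumes "\<exists>B. finite B \<and> H = span B" "linear f" "v \<in> H" "norm v \<le> B"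
  shows "\<bar>f v\<bar> \<le> fun_norm H f * B"
  using fun_norm_bound[OF assms(1-3)] mult_left_mono[OF assms(4) fun_norm_nonneg[OF assms(1,2)]]
  by linarith

lemma bil_norm_le:
  fixes b :: "'v::real_inner \<Rightarrow> 'v \<Rightarrow> real"
  assumes "\<exists>B. finite B \<and> H = span B" "bilinear b" "u \<in> H" "v \<in> H" "norm u \<le> A" "norm v \<le> B"
  shows "\<bar>b u v\<bar> \<le> bil_norm H b * (A * B)"
proof -
  have "norm u * norm v \<le> A * B"
    using assms(5,6) by (meson mult_mono norm_ge_zero order_trans)
  then show ?thesis
    using bil_norm_bound[OF assms(1-4)] mult_left_mono[OF _ bil_norm_nonneg[OF assms(1,2)]]
    by fastforce
qed

lemma coercivity_const_bound:
  assumes "\<And>v. \<alpha> * (norm v)\<^sup>2 \<le> b v v" "v \<in> H"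
  shows "coercivity_const H b * (norm v)\<^sup>2 \<le> b v v"
proof (cases "v = 0")
  case True
  then show ?thesis using assms(1)[of 0] by simp
next
  case False
  have "bdd_below ((\<lambda>v. b v v / (norm v)\<^sup>2) ` (H - {0}))"
    using assms(1) by (intro bdd_belowI2[where m = \<alpha>]) (simp add: le_divide_eq)
  then have "coercivity_const H b \<le> b v v / (norm v)\<^sup>2"
    unfolding coercivity_const_def using assms(2) False by (intro cINF_lower) auto
  then show ?thesis using False by (simp add: le_divide_eq)
qed

text \<open>Nontriviality of \<open>H\<close> keeps the infimum from ranging over the empty
  set.\<close>

lemma coercivity_const_pos:
  assumes "0 < \<alpha>" "\<And>v. \<alpha> * (norm v)\<^sup>2 \<le> b v v" "\<not> H \<subseteq> {0}"
  shows "0 < coercivity_const H b"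
proof -
  have "\<alpha> \<le> coercivity_const H b"
    unfolding coercivity_const_def using assms by (intro cINF_greatest) (auto simp: le_divide_eq)
  with assms(1) show ?thesis by simp
qed

text \<open>Dimension count: a vector outside the image, added to the image of the basis, would give
  \<open>card B + 1\<close> independent vectors in \<open>span B\<close>.\<close>

lemma linear_inj_on_span_surj:
  fixes f :: "'a::real_vector \<Rightarrow> 'a"
  assumes "linear f" "finite B" "independent B" "inj_on f (span B)" "f ` span B \<subseteq> span B"
  shows "f ` span B = span B"
proof (rule ccontr)
  assume "f ` span B \<noteq> span B"
  then obtain y where y: "y \<in> span B" "y \<notin> span (f ` B)"
    using assms by (auto simp: linear_span_image)
  have "independent (f ` B)"
    by (rule linear_independent_injective_image[OF assms(1,3,4)])
  then have "independent (insert y (f ` B))"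
    using y(2) span_base by (auto simp: independent_insert)
  moreover have "insert y (f ` B) \<subseteq> span B"
    using y assms(5) span_superset[of B] by auto
  ultimately have "card (insert y (f ` B)) \<le> card B"
    using independent_span_bound[OF assms(2)] by blast
  moreover have "card (insert y (f ` B)) = Suc (card (f ` B))"
    using y(2) assms(2) span_base[of y "f ` B"] by (intro card_insert_disjoint) auto
  moreover have "card (f ` B) = card B"
    using inj_on_subset[OF assms(4) span_superset] by (rule card_image)
  ultimately show False by simp
qed

section \<open>Galerkin problems\<close>

lemma galerkin_unique:
  fixes A :: "'v::real_inner \<Rightarrow> 'v \<Rightarrow> real"
  assumes "subspace W" "bilinear A" "\<And>v. v \<in> W \<Longrightarrow> v \<noteq> 0 \<Longrightarrow> 0 < A v v"
    and "u \<in> W" "u' \<in> W" "\<And>v. v \<in> W \<Longrightarrow> A u v = A u' v"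
  shows "u = u'"
proof (rule ccontr)
  assume "u \<noteq> u'"
  moreover have "u - u' \<in> W" using assms by (simp add: subspace_diff)
  ultimately show False
    using assms(3)[of "u - u'"] assms(6)[of "u - u'"] by (simp add: bilinear_lsub[OF assms(2)])
qed

text \<open>Finite-dimensional Lax-Milgram without symmetry of \<open>A\<close>: positivity on the
  diagonal gives injectivity, and finite dimension turns injectivity into surjectivity.\<close>

lemma galerkin_ex1:
  fixes A :: "'v::real_inner \<Rightarrow> 'v \<Rightarrow> real"
  assumes fd: "\<exists>B. finite B \<and> W = span B" and A: "bilinear A" and F: "linear F"
    and pos: "\<And>v. v \<in> W \<Longrightarrow> v \<noteq> 0 \<Longrightarrow> 0 < A v v"
  shows "\<exists>!u. u \<in> W \<and> (\<forall>v\<in>W. A u v = F v)"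
proof -
  have W: "subspace W" using fd by auto
  obtain C where C: "orthonormal_basis C W"
    using orthonormal_basis_exists[OF fd] ..
  have sum_in: "(\<Sum>c\<in>C. r c *\<^sub>R c) \<in> W" for r
    using C unfolding orthonormal_basis_def by (auto intro: span_sum span_scale span_base)
  have coeff: "(\<Sum>c\<in>C. r c *\<^sub>R c) \<bullet> d = r d" if "d \<in> C" for r d
  proof -
    have "(\<Sum>c\<in>C. r c *\<^sub>R c) \<bullet> d = (\<Sum>c\<in>C. if c = d then r c else 0)"
      unfolding inner_sum_left using that C by (intro sum.cong) (auto simp: orthonormal_basis_def)
    then show ?thesis using C that by (simp add: orthonormal_basis_def)
  qed
  \<comment> \<open>\<open>T u\<close> is the Riesz representative of \<open>A u\<close> in
    \<open>W\<close>, so the variational equation becomes a linear equation in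
    \<open>W\<close>.\<close>
  define T where "T u = (\<Sum>c\<in>C. A u c *\<^sub>R c)" for u
  have T: "linear T"
    unfolding T_def using A
    by (intro linearI)
      (simp_all add: bilinear_ladd bilinear_lmul scaleR_left_distrib sum.distrib scaleR_sum_right)
  have test: "A u v = T u \<bullet> v" if "v \<in> W" for u v
  proof -
    have "A u v = (\<Sum>c\<in>C. (v \<bullet> c) * A u c)"
      using A C that by (intro linear_expansion) (auto simp: bilinear_def)
    then show ?thesis
      by (simp add: T_def inner_sum_left mult.commute inner_commute[of v])
  qed
  have "inj_on T W"
  proof (rule inj_onI)
    fix u u' assume "u \<in> W" "u' \<in> W" "T u = T u'"
    then show "u = u'"
      using galerkin_unique[OF W A pos] test by metis
  qed
  then have "T ` W = W"
    using linear_inj_on_span_surj[OF T _ orthonormal_basis_independent[OF C]] sum_in C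
    by (auto simp: T_def orthonormal_basis_def)
  then obtain u where u: "u \<in> W" "T u = (\<Sum>c\<in>C. F c *\<^sub>R c)"
    using sum_in by (metis imageE)
  have "A u v = F v" if "v \<in> W" for v
    using linear_expansion[OF F C that] test[OF that, of u] u(2)
    by (simp add: inner_sum_left mult.commute inner_commute[of v])
  then show ?thesis
    using u(1) galerkin_unique[OF W A pos] by metis
qed

text \<open>\<open>solution_in\<close> is a definite description and says nothing before unique
  existence is known.\<close>

lemma solution_in_galerkin:
  fixes A :: "'v::real_inner \<Rightarrow> 'v \<Rightarrow> real"
  assumes "\<exists>B. finite B \<and> W = span B" "bilinear A" "linear F"
    and "\<And>v. v \<in> W \<Longrightarrow> v \<noteq> 0 \<Longrightarrow> 0 < A v v"
    and E: "\<And>u v. u \<in> W \<Longrightarrow> v \<in> W \<Longrightarrow> E u v \<longleftrightarrow> A u v = F v"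
  shows "solution_in W E \<in> W" "\<And>v. v \<in> W \<Longrightarrow> A (solution_in W E) v = F v"
proof -
  have eq: "(u \<in> W \<and> (\<forall>v\<in>W. E u v)) \<longleftrightarrow> (u \<in> W \<and> (\<forall>v\<in>W. A u v = F v))" for u
    using E by blast
  have "\<exists>!u. u \<in> W \<and> (\<forall>v\<in>W. E u v)"
    unfolding eq by (rule galerkin_ex1[OF assms(1-4)])
  then have "solution_in W E \<in> W \<and> (\<forall>v\<in>W. E (solution_in W E) v)"
    unfolding solution_in_def by (rule theI')
  then have in_W: "solution_in W E \<in> W" and sol: "\<And>v. v \<in> W \<Longrightarrow> E (solution_in W E) v"
    by blast+
  show "solution_in W E \<in> W" by (fact in_W)
  show "A (solution_in W E) v = F v" if "v \<in> W" for v
    using E[OF in_W that] sol[OF that] by simp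
qed

text \<open>Implicit differentiation: \<open>y'\<close> solves the formally differentiated equation,
  and stability of the form \<open>A t\<close> bounds the error of the difference quotient by a
  residual that tends to zero. Coercivity is required at \<open>0\<close> only, since it persists
  for small \<open>t\<close>.\<close>

lemma galerkin_has_vector_derivative:
  fixes A :: "real \<Rightarrow> 'v::real_inner \<Rightarrow> 'v \<Rightarrow> real"
  assumes fd: "\<exists>B. finite B \<and> W = span B" and "0 \<in> T"
    and A: "\<And>t. t \<in> T \<Longrightarrow> bilinear (A t)" and F: "\<And>t. t \<in> T \<Longrightarrow> linear (F t)"
    and A': "bilinear A'" and F': "linear F'"
    and dA: "\<And>u v. ((\<lambda>t. A t u v) has_vector_derivative A' u v) (at 0 within T)"
    and dF: "\<And>v. ((\<lambda>t. F t v) has_vector_derivative F' v) (at 0 within T)"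
    and "0 < \<alpha>" and coer: "\<And>v. v \<in> W \<Longrightarrow> \<alpha> * (norm v)\<^sup>2 \<le> A 0 v v"
    and y: "\<And>t. t \<in> T \<Longrightarrow> y t \<in> W" "\<And>t v. t \<in> T \<Longrightarrow> v \<in> W \<Longrightarrow> A t (y t) v = F t v"
    and y': "y' \<in> W" "\<And>v. v \<in> W \<Longrightarrow> A 0 y' v = F' v - A' (y 0) v"
  shows "(y has_vector_derivative y') (at 0 within T)"
proof -
  have quot: "((\<lambda>t. (f t - f 0) / t) \<longlongrightarrow> f') (at 0 within T)"
    if "(f has_vector_derivative f') (at 0 within T)" for f :: "real \<Rightarrow> real" and f'
    using that
    unfolding has_real_derivative_iff_has_vector_derivative[symmetric] has_field_derivative_iff
    by simp
  have cont: "((\<lambda>t. f t) \<longlongrightarrow> f 0) (at 0 within T)"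
    if "(f has_vector_derivative f') (at 0 within T)" for f :: "real \<Rightarrow> real" and f'
    using has_vector_derivative_continuous[OF that] by (simp add: continuous_within)
  have W: "subspace W" using fd by auto
  obtain C where C: "orthonormal_basis C W"
    using orthonormal_basis_exists[OF fd] ..
  \<comment> \<open>\<open>e\<close> is the error of the difference quotient. Inserting it into
    \<open>A t\<close> and using the equations at \<open>t\<close>, at \<open>0\<close> and for
    \<open>y'\<close> leaves exactly \<open>R t\<close>.\<close>
  define e where "e t = (1 / t) *\<^sub>R (y t - y 0) - y'" for t
  define R where "R t v = ((F t v - F 0 v) / t - F' v)
    - ((A t (y 0) v - A 0 (y 0) v) / t - A' (y 0) v) - (A t y' v - A 0 y' v)" for t v
  \<comment> \<open>These finite sums majorise the norms of \<open>R t\<close> and of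
    \<open>A t - A 0\<close> on \<open>W\<close>, so limits at fixed arguments suffice.\<close>
  define \<rho> where "\<rho> t = (\<Sum>c\<in>C. \<bar>R t c\<bar>)" for t
  define \<delta> where "\<delta> t = (\<Sum>c\<in>C. \<Sum>d\<in>C. \<bar>A t c d - A 0 c d\<bar>)" for t
  have e: "e t \<in> W" if "t \<in> T" for t
    using y(1) y'(1) that \<open>0 \<in> T\<close> W unfolding e_def by (intro subspace_diff subspace_scale)
  have lin: "linear (A t u)" if "t \<in> T" for t u
    using A[OF that] by (simp add: bilinear_def)
  have R_linear: "linear (R t)" if "t \<in> T" for t
  proof (rule linearI)
    show "R t (u + v) = R t u + R t v" for u v
      using lin F F' A' that \<open>0 \<in> T\<close>
      by (simp add: R_def linear_add bilinear_def diff_divide_distrib add_divide_distrib)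
    show "R t (r *\<^sub>R v) = r *\<^sub>R R t v" for r v
      using lin F F' A' that \<open>0 \<in> T\<close>
      by (simp add: R_def linear_scale bilinear_def algebra_simps diff_divide_distrib)
  qed
  have R: "A t (e t) v = R t v" if "t \<in> T" "t \<noteq> 0" "v \<in> W" for t v
    using y(2)[OF that(1,3)] y(2)[OF \<open>0 \<in> T\<close> that(3)] y'(2)[OF that(3)] that(2)
    by (simp add: e_def R_def bilinear_lsub[OF A[OF that(1)]] bilinear_lmul[OF A[OF that(1)]]
        diff_divide_distrib)
  have \<rho>: "(\<rho> \<longlongrightarrow> 0) (at 0 within T)"
  proof -
    have "((\<lambda>t. R t c) \<longlongrightarrow> (F' c - F' c) - (A' (y 0) c - A' (y 0) c) - (A 0 y' c - A 0 y' c))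
        (at 0 within T)" for c
      unfolding R_def
      by (intro tendsto_diff tendsto_const quot[OF dA] quot[OF dF] cont[OF dA])
    then have "((\<lambda>t. \<Sum>c\<in>C. \<bar>R t c\<bar>) \<longlongrightarrow> (\<Sum>c\<in>C. \<bar>0\<bar>)) (at 0 within T)"
      by (intro tendsto_sum tendsto_rabs) simp
    then show ?thesis by (simp add: \<rho>_def[abs_def])
  qed
  have "(\<delta> \<longlongrightarrow> (\<Sum>c\<in>C. \<Sum>d\<in>C. \<bar>A 0 c d - A 0 c d\<bar>)) (at 0 within T)"
    unfolding \<delta>_def[abs_def] by (intro tendsto_intros cont[OF dA])
  then have "(\<delta> \<longlongrightarrow> 0) (at 0 within T)" by simp
  \<comment> \<open>For such \<open>t\<close> the form \<open>A t\<close> keeps at least half of the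
    coercivity constant.\<close>
  then have \<delta>: "\<forall>\<^sub>F t in at 0 within T. \<delta> t < \<alpha> / 2"
    using \<open>0 < \<alpha>\<close> by (intro order_tendstoD) auto
  have coer_t: "(\<alpha> - \<delta> t) * (norm v)\<^sup>2 \<le> A t v v" if "t \<in> T" "v \<in> W" for t v
  proof -
    have "bilinear (\<lambda>u v. A t u v - A 0 u v)"
      using A[OF that(1)] A[OF \<open>0 \<in> T\<close>]
      by (auto simp: bilinear_def intro: linear_compose_sub)
    from bilinear_bound_finite_dim[OF this C that(2) that(2)]
    have "\<bar>A t v v - A 0 v v\<bar> \<le> \<delta> t * (norm v)\<^sup>2"
      by (simp add: \<delta>_def power2_eq_square)
    with coer[OF that(2)] show ?thesis by (simp add: algebra_simps)
  qed
  have in_T: "\<forall>\<^sub>F t in at 0 within T. t \<in> T \<and> t \<noteq> 0"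
    by (simp add: eventually_at_filter)
  have bound: "\<forall>\<^sub>F t in at 0 within T. norm (e t) \<le> 2 / \<alpha> * \<rho> t"
    using \<delta> in_T
  proof eventually_elim
    case (elim t)
    then have et: "e t \<in> W" by (simp add: e)
    have "\<alpha> / 2 * (norm (e t))\<^sup>2 \<le> (\<alpha> - \<delta> t) * (norm (e t))\<^sup>2"
      using elim by (intro mult_right_mono) auto
    also have "\<dots> \<le> R t (e t)"
      using coer_t[of t, OF _ et] R[of t, OF _ _ et] elim by simp
    also have "\<dots> \<le> \<rho> t * norm (e t)"
      using linear_bound_finite_dim[OF R_linear C et] elim
      unfolding \<rho>_def by (meson abs_le_D1)
    finally have "\<alpha> / 2 * norm (e t) \<le> \<rho> t" if "e t \<noteq> 0"
      using that by (simp add: power2_eq_square)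
    moreover have "0 \<le> \<rho> t" by (simp add: \<rho>_def sum_nonneg)
    ultimately show ?case
      using \<open>0 < \<alpha>\<close> by (cases "e t = 0") (auto simp: field_simps)
  qed
  have "(e \<longlongrightarrow> 0) (at 0 within T)"
    by (rule Lim_null_comparison[OF bound]) (use tendsto_mult_left[OF \<rho>, of "2/\<alpha>"] in simp)
  then have "((\<lambda>t. norm (e t)) \<longlongrightarrow> 0) (at 0 within T)"
    by (rule tendsto_norm_zero)
  moreover have "\<forall>\<^sub>F t in at 0 within T.
      norm (e t) = norm ((y t - y 0) - (t - 0) *\<^sub>R y') / norm (t - 0)"
    using in_T
  proof eventually_elim
    case (elim t)
    have "e t = (1 / t) *\<^sub>R ((y t - y 0) - (t - 0) *\<^sub>R y')"
      using elim by (simp add: e_def scaleR_diff_right)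
    then show ?case by simp
  qed
  ultimately show ?thesis
    unfolding has_vector_derivative_def has_derivative_iff_norm
    by (auto simp: bounded_linear_scaleR_left elim: Lim_transform_eventually)
qed

section \<open>Derivatives along coordinate directions\<close>

text \<open>A predicate beside \<open>pdiff\<close>, because \<open>vector_derivative\<close> is a
  choice that carries no information unless a derivative exists. Vector values are allowed in order
  to cover the solution maps.\<close>

definition has_pd ::
    "(real^'p) set \<Rightarrow> 'p \<Rightarrow> (real^'p \<Rightarrow> 'b::real_normed_vector) \<Rightarrow> 'b \<Rightarrow> real^'p \<Rightarrow> bool" where
  "has_pd S i f f' x \<longleftrightarrow>
     ((\<lambda>t. f (x + t *\<^sub>R axis i 1)) has_vector_derivative f') (at 0 within {t. x + t *\<^sub>R axis i 1 \<in> S})"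

lemma has_pd_const: "has_pd S i (\<lambda>_. c) 0 x"
  by (simp add: has_pd_def)

lemma has_pd_add: "has_pd S i f f' x \<Longrightarrow> has_pd S i g g' x \<Longrightarrow> has_pd S i (\<lambda>m. f m + g m) (f' + g') x"
  unfolding has_pd_def by (rule has_vector_derivative_add)

lemma has_pd_diff: "has_pd S i f f' x \<Longrightarrow> has_pd S i g g' x \<Longrightarrow> has_pd S i (\<lambda>m. f m - g m) (f' - g') x"
  unfolding has_pd_def by (rule has_vector_derivative_diff)

lemma has_pd_sum:
  "(\<And>c. c \<in> C \<Longrightarrow> has_pd S i (f c) (f' c) x) \<Longrightarrow> has_pd S i (\<lambda>m. \<Sum>c\<in>C. f c m) (\<Sum>c\<in>C. f' c) x"
  unfolding has_pd_def by (rule has_vector_derivative_sum)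

lemma has_pd_mult:
  fixes f g :: "real^'p \<Rightarrow> real"
  assumes "has_pd S i f f' x" "has_pd S i g g' x"
  shows "has_pd S i (\<lambda>m. f m * g m) (f x * g' + f' * g x) x"
  using bounded_bilinear.has_vector_derivative[OF bounded_bilinear_mult
      assms[unfolded has_pd_def]]
  by (simp add: has_pd_def)

lemma has_pd_cmult:
  fixes f :: "real^'p \<Rightarrow> real"
  shows "has_pd S i f f' x \<Longrightarrow> has_pd S i (\<lambda>m. c * f m) (c * f') x"
  using has_pd_mult[OF has_pd_const[of S i c x], of f f'] by simp

lemma has_pd_inner:
  assumes "has_pd S i u u' x"
  shows "has_pd S i (\<lambda>m. u m \<bullet> c) (u' \<bullet> c) x"
  using assms unfolding has_pd_def
  by (rule bounded_linear.has_vector_derivative[OF bounded_linear_inner_left])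

lemma has_pd_transform:
  assumes "has_pd S i f f' x" "x \<in> S" "\<And>m. m \<in> S \<Longrightarrow> g m = f m"
  shows "has_pd S i g f' x"
  using assms unfolding has_pd_def
  by (intro has_vector_derivative_transform[OF _ _ assms(1)[unfolded has_pd_def]]) auto

lemma has_pd_Frechet:
  assumes "(f has_derivative f') (at x within S)"
  shows "has_pd S i f (f' (axis i 1)) x"
proof -
  let ?T = "{t. x + t *\<^sub>R axis i 1 \<in> S}"
  have "((\<lambda>t. x + t *\<^sub>R axis i 1) has_derivative (\<lambda>t. t *\<^sub>R axis i 1)) (at 0 within ?T)"
    by (auto intro!: derivative_eq_intros)
  moreover have "(f has_derivative f')
      (at (x + 0 *\<^sub>R axis i 1) within ((\<lambda>t. x + t *\<^sub>R axis i 1) ` ?T))"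
    using assms by (auto intro: has_derivative_subset)
  ultimately have "((\<lambda>t. f (x + t *\<^sub>R axis i 1)) has_derivative (\<lambda>t. f' (t *\<^sub>R axis i 1)))
      (at 0 within ?T)"
    by (rule has_derivative_in_compose)
  then show ?thesis
    using has_derivative_bounded_linear[OF assms]
    by (simp add: has_pd_def has_vector_derivative_def bounded_linear.linear linear_scale)
qed

text \<open>The derivative of \<open>f m v\<close> is known for fixed \<open>v\<close> only. In
  coordinates the expression is a finite sum of products of real functions, so no joint
  differentiability has to be established.\<close>

lemma has_pd_linear_form:
  fixes f :: "real^'p \<Rightarrow> 'v::real_inner \<Rightarrow> real"
  assumes fd: "\<exists>B. finite B \<and> H = span B" and x: "x \<in> S"
    and f: "\<And>m. m \<in> S \<Longrightarrow> linear (f m)" "linear f'" "\<And>v. has_pd S i (\<lambda>m. f m v) (f' v) x"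
    and v: "\<And>m. m \<in> S \<Longrightarrow> v m \<in> H" "v' \<in> H" "has_pd S i v v' x"
  shows "has_pd S i (\<lambda>m. f m (v m)) (f' (v x) + f x v') x"
proof -
  obtain C where C: "orthonormal_basis C H"
    using orthonormal_basis_exists[OF fd] ..
  have "has_pd S i (\<lambda>m. \<Sum>c\<in>C. (v m \<bullet> c) * f m c) (\<Sum>c\<in>C. (v x \<bullet> c) * f' c + (v' \<bullet> c) * f x c) x"
    by (intro has_pd_sum has_pd_mult has_pd_inner f v)
  moreover have "(\<Sum>c\<in>C. (v x \<bullet> c) * f' c + (v' \<bullet> c) * f x c) = f' (v x) + f x v'"
    using linear_expansion[OF f(2) C v(1)[OF x]] linear_expansion[OF f(1)[OF x] C v(2)]
    by (simp add: sum.distrib)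
  ultimately have "has_pd S i (\<lambda>m. \<Sum>c\<in>C. (v m \<bullet> c) * f m c) (f' (v x) + f x v') x"
    by simp
  then show ?thesis
    using x by (rule has_pd_transform) (intro linear_expansion[OF _ C] f v)
qed

lemma has_pd_bilinear_form:
  fixes b :: "real^'p \<Rightarrow> 'v::real_inner \<Rightarrow> 'v \<Rightarrow> real"
  assumes fd: "\<exists>B. finite B \<and> H = span B" and x: "x \<in> S"
    and b: "\<And>m. m \<in> S \<Longrightarrow> bilinear (b m)" "bilinear b'" "\<And>u v. has_pd S i (\<lambda>m. b m u v) (b' u v) x"
    and u: "\<And>m. m \<in> S \<Longrightarrow> u m \<in> H" "u' \<in> H" "has_pd S i u u' x"
    and v: "\<And>m. m \<in> S \<Longrightarrow> v m \<in> H" "v' \<in> H" "has_pd S i v v' x"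
  shows "has_pd S i (\<lambda>m. b m (u m) (v m)) (b' (u x) (v x) + b x u' (v x) + b x (u x) v') x"
proof -
  obtain C where C: "orthonormal_basis C H"
    using orthonormal_basis_exists[OF fd] ..
  let ?f = "\<lambda>m. \<Sum>c\<in>C. \<Sum>d\<in>C. ((u m \<bullet> c) * (v m \<bullet> d)) * b m c d"
  have "has_pd S i ?f (\<Sum>c\<in>C. \<Sum>d\<in>C. ((u x \<bullet> c) * (v x \<bullet> d)) * b' c d
      + ((u x \<bullet> c) * (v' \<bullet> d) + (u' \<bullet> c) * (v x \<bullet> d)) * b x c d) x"
    by (intro has_pd_sum has_pd_mult has_pd_inner b u v)
  moreover have "(\<Sum>c\<in>C. \<Sum>d\<in>C. ((u x \<bullet> c) * (v x \<bullet> d)) * b' c d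
      + ((u x \<bullet> c) * (v' \<bullet> d) + (u' \<bullet> c) * (v x \<bullet> d)) * b x c d)
      = b' (u x) (v x) + b x u' (v x) + b x (u x) v'"
    using bilinear_expansion[OF b(2) C u(1)[OF x] v(1)[OF x]]
      bilinear_expansion[OF b(1)[OF x] C u(2) v(1)[OF x]]
      bilinear_expansion[OF b(1)[OF x] C u(1)[OF x] v(2)]
    by (simp add: sum.distrib distrib_right)
  ultimately have "has_pd S i ?f (b' (u x) (v x) + b x u' (v x) + b x (u x) v') x"
    by simp
  then show ?thesis
    using x by (rule has_pd_transform) (intro bilinear_expansion[OF _ C] b u v)
qed

lemma galerkin_has_pd:
  fixes A :: "real^'p \<Rightarrow> 'v::real_inner \<Rightarrow> 'v \<Rightarrow> real"
  assumes fd: "\<exists>B. finite B \<and> W = span B" and x: "x \<in> S"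
    and A: "\<And>m. m \<in> S \<Longrightarrow> bilinear (A m)" and F: "\<And>m. m \<in> S \<Longrightarrow> linear (F m)"
    and A': "bilinear A'" and F': "linear F'"
    and dA: "\<And>u v. has_pd S i (\<lambda>m. A m u v) (A' u v) x"
    and dF: "\<And>v. has_pd S i (\<lambda>m. F m v) (F' v) x"
    and "0 < \<alpha>" and coer: "\<And>v. v \<in> W \<Longrightarrow> \<alpha> * (norm v)\<^sup>2 \<le> A x v v"
    and y: "\<And>m. m \<in> S \<Longrightarrow> y m \<in> W" "\<And>m v. m \<in> S \<Longrightarrow> v \<in> W \<Longrightarrow> A m (y m) v = F m v"
    and y': "y' \<in> W" "\<And>v. v \<in> W \<Longrightarrow> A x y' v = F' v - A' (y x) v"
  shows "has_pd S i y y' x"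
  unfolding has_pd_def
proof (rule galerkin_has_vector_derivative[OF fd, where A = "\<lambda>t. A (x + t *\<^sub>R axis i 1)"
      and F = "\<lambda>t. F (x + t *\<^sub>R axis i 1)" and A' = A' and F' = F' and \<alpha> = \<alpha>])
qed (use assms in \<open>auto simp: has_pd_def\<close>)

section \<open>Iterated partial derivatives on a nondegenerate box\<close>

locale param_box =
  fixes S :: "(real^'p) set" and lo hi :: "real^'p"
  assumes S_eq: "S = cbox lo hi" and lo_less_hi: "\<And>i. lo $ i < hi $ i"
begin

text \<open>One-sided derivatives are unique here because the admissible \<open>t\<close> form an
  interval of positive length containing \<open>0\<close>.\<close>

lemma pdiff_eqI:
  assumes "has_pd S i f f' x" "x \<in> S"
  shows "pdiff S i f x = f'"
proof -
  have "{t. x + t *\<^sub>R axis i 1 \<in> S} = cbox (lo $ i - x $ i) (hi $ i - x $ i)"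
  proof (intro set_eqI iffI)
    fix t assume "t \<in> {t. x + t *\<^sub>R axis i 1 \<in> S}"
    then have "lo $ i \<le> (x + t *\<^sub>R axis i 1) $ i" "(x + t *\<^sub>R axis i 1) $ i \<le> hi $ i"
      unfolding S_eq mem_Collect_eq mem_box_cart by blast+
    then show "t \<in> cbox (lo $ i - x $ i) (hi $ i - x $ i)" by simp
  next
    fix t assume "t \<in> cbox (lo $ i - x $ i) (hi $ i - x $ i)"
    then show "t \<in> {t. x + t *\<^sub>R axis i 1 \<in> S}"
      using assms(2) by (auto simp: S_eq mem_box_cart axis_def)
  qed
  moreover have "0 \<in> {t. x + t *\<^sub>R axis i 1 \<in> S}" using assms(2) by simp
  ultimately show ?thesis
    using assms(1) lo_less_hi[of i] vector_derivative_within_cbox[of "lo $ i - x $ i" "hi $ i - x $ i" 0]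
    unfolding pdiff_def has_pd_def by simp
qed

definition twice_pd :: "(real^'p \<Rightarrow> real) \<Rightarrow> bool" where
  "twice_pd f \<longleftrightarrow> (\<forall>x\<in>S. \<forall>i l.
     has_pd S i f (pdiff S i f x) x \<and> has_pd S l (pdiff S i f) (pdiff2 S i l f x) x)"

lemma twice_pdI:
  assumes f: "\<And>x i. x \<in> S \<Longrightarrow> has_pd S i f (f' i x) x"
    and f': "\<And>x i l. x \<in> S \<Longrightarrow> has_pd S l (f' i) (f'' i l x) x"
  shows "twice_pd f"
    and "x \<in> S \<Longrightarrow> pdiff S i f x = f' i x" and "x \<in> S \<Longrightarrow> pdiff2 S i l f x = f'' i l x"
proof -
  have 1: "pdiff S i f x = f' i x" if "x \<in> S" for x i
    using pdiff_eqI[OF f] that by blast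
  \<comment> \<open>The first derivatives are identified on \<open>S\<close> only, which is enough
    because the next derivative is also relative to \<open>S\<close>.\<close>
  have 2: "has_pd S l (pdiff S i f) (f'' i l x) x" if "x \<in> S" for x i l
    by (rule has_pd_transform[OF f' that]) (use that 1 in auto)
  have 3: "pdiff2 S i l f x = f'' i l x" if "x \<in> S" for x i l
    unfolding pdiff2_def by (rule pdiff_eqI[OF 2 that]) (rule that)
  show "twice_pd f" using f 1 2 3 by (simp add: twice_pd_def)
  show "x \<in> S \<Longrightarrow> pdiff S i f x = f' i x" "x \<in> S \<Longrightarrow> pdiff2 S i l f x = f'' i l x"
    using 1 3 by blast+
qed

lemma twice_pd_has_pd:
  assumes "twice_pd f" "x \<in> S"
  shows "has_pd S i f (pdiff S i f x) x" "has_pd S l (pdiff S i f) (pdiff2 S i l f x) x"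
  using assms by (simp_all add: twice_pd_def)

lemma twice_pd_lincomb:
  assumes "twice_pd f" "twice_pd g"
  shows "twice_pd (\<lambda>m. r * f m + s * g m)"
    and "x \<in> S \<Longrightarrow> pdiff S i (\<lambda>m. r * f m + s * g m) x = r * pdiff S i f x + s * pdiff S i g x"
    and "x \<in> S \<Longrightarrow> pdiff2 S i l (\<lambda>m. r * f m + s * g m) x = r * pdiff2 S i l f x + s * pdiff2 S i l g x"
proof -
  let ?h = "\<lambda>m. r * f m + s * g m"
  let ?h' = "\<lambda>i x. r * pdiff S i f x + s * pdiff S i g x"
  let ?h'' = "\<lambda>i l x. r * pdiff2 S i l f x + s * pdiff2 S i l g x"
  have 1: "has_pd S i ?h (?h' i x) x" if "x \<in> S" for x i
    by (intro has_pd_add has_pd_cmult twice_pd_has_pd assms that)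
  have 2: "has_pd S l (?h' i) (?h'' i l x) x" if "x \<in> S" for x i l
    by (intro has_pd_add has_pd_cmult twice_pd_has_pd assms that)
  show "twice_pd ?h"
    by (rule twice_pdI(1)[of ?h ?h' ?h'', OF 1 2])
  show "x \<in> S \<Longrightarrow> pdiff S i ?h x = ?h' i x"
    by (rule twice_pdI(2)[of ?h ?h' ?h'', OF 1 2])
  show "x \<in> S \<Longrightarrow> pdiff2 S i l ?h x = ?h'' i l x"
    by (rule twice_pdI(3)[of ?h ?h' ?h'', OF 1 2])
qed

lemma twice_pd_cong:
  assumes "twice_pd f" "\<And>m. m \<in> S \<Longrightarrow> g m = f m"
  shows "twice_pd g"
proof (rule twice_pdI(1)[where f' = "\<lambda>i. pdiff S i f" and f'' = "\<lambda>i l. pdiff2 S i l f"])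
  show "has_pd S i g (pdiff S i f x) x" if "x \<in> S" for x i
    by (rule has_pd_transform[OF twice_pd_has_pd(1)[OF assms(1) that] that assms(2)])
  show "has_pd S l (pdiff S i f) (pdiff2 S i l f x) x" if "x \<in> S" for x i l
    by (rule twice_pd_has_pd(2)[OF assms(1) that])
qed

text \<open>A form applied to a vanishing auxiliary function is the zero function of the parameter;
  these rules then remove its derivatives.\<close>

lemma pdiff_zero [simp]:
  "x \<in> S \<Longrightarrow> pdiff S i (\<lambda>_. 0) x = 0" "x \<in> S \<Longrightarrow> pdiff2 S i l (\<lambda>_. 0) x = 0"
  using twice_pdI(2,3)[of "\<lambda>_. 0" "\<lambda>_ _. 0" "\<lambda>_ _ _. 0", OF has_pd_const has_pd_const] by blast+

text \<open>The functional \<phi> evaluates an operator-valued map at fixed vectors, which reduces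
  smoothness of forms to that of real functions.\<close>

lemma C2_imp_twice_pd:
  fixes f :: "real^'p \<Rightarrow> 'b::real_normed_vector" and \<phi> :: "'b \<Rightarrow> real"
  assumes "C2_loc_Lipschitz_on S f" "bounded_linear \<phi>"
  shows "twice_pd (\<lambda>m. \<phi> (f m))"
proof -
  obtain f' :: "real^'p \<Rightarrow> (real^'p) \<Rightarrow>\<^sub>L 'b" and f'' :: "real^'p \<Rightarrow> (real^'p) \<Rightarrow>\<^sub>L (real^'p) \<Rightarrow>\<^sub>L 'b"
    where 1: "\<And>x. x \<in> S \<Longrightarrow> (f has_derivative f' x) (at x within S)"
      and 2: "\<And>x. x \<in> S \<Longrightarrow> (f' has_derivative f'' x) (at x within S)"
    using assms(1) unfolding C2_loc_Lipschitz_on_def by blast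
  show ?thesis
  proof (rule twice_pdI(1)[where f' = "\<lambda>i x. \<phi> (f' x (axis i 1))"
        and f'' = "\<lambda>i l x. \<phi> (f'' x (axis l 1) (axis i 1))"])
    fix x i assume x: "x \<in> S"
    show "has_pd S i (\<lambda>m. \<phi> (f m)) (\<phi> (f' x (axis i 1))) x"
      by (rule has_pd_Frechet[OF bounded_linear.has_derivative[OF assms(2) 1[OF x]]])
  next
    fix x i l assume x: "x \<in> S"
    have "((\<lambda>m. f' m (axis i 1)) has_derivative (\<lambda>h. f'' x h (axis i 1))) (at x within S)"
      by (rule bounded_linear.has_derivative[OF blinfun.bounded_linear_left 2[OF x]])
    from has_pd_Frechet[OF bounded_linear.has_derivative[OF assms(2) this]]
    show "has_pd S l (\<lambda>m. \<phi> (f' m (axis i 1))) (\<phi> (f'' x (axis l 1) (axis i 1))) x" .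
  qed
qed

lemma linear_pdiff:
  assumes "\<And>m. linear (f m)" "\<And>v. twice_pd (\<lambda>m. f m v)" "x \<in> S"
  shows "linear (\<lambda>v. pdiff S i (\<lambda>m. f m v) x)" "linear (\<lambda>v. pdiff2 S i l (\<lambda>m. f m v) x)"
proof -
  have add: "(\<lambda>m. f m (u + v)) = (\<lambda>m. 1 * f m u + 1 * f m v)" for u v
    using assms(1) by (simp add: linear_add)
  \<comment> \<open>The zero summand makes scaling an instance of the same two-term rule as
    addition.\<close>
  have scale: "(\<lambda>m. f m (r *\<^sub>R v)) = (\<lambda>m. r * f m v + 0 * f m v)" for r v
    using assms(1) by (simp add: linear_scale)
  show "linear (\<lambda>v. pdiff S i (\<lambda>m. f m v) x)"
  proof (rule linearI)
    show "pdiff S i (\<lambda>m. f m (u + v)) x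
      = pdiff S i (\<lambda>m. f m u) x + pdiff S i (\<lambda>m. f m v) x" for u v
      unfolding add twice_pd_lincomb(2)[OF assms(2) assms(2) assms(3)] by simp
    show "pdiff S i (\<lambda>m. f m (r *\<^sub>R v)) x = r *\<^sub>R pdiff S i (\<lambda>m. f m v) x" for r v
      unfolding scale twice_pd_lincomb(2)[OF assms(2) assms(2) assms(3)] by simp
  qed
  show "linear (\<lambda>v. pdiff2 S i l (\<lambda>m. f m v) x)"
  proof (rule linearI)
    show "pdiff2 S i l (\<lambda>m. f m (u + v)) x
      = pdiff2 S i l (\<lambda>m. f m u) x + pdiff2 S i l (\<lambda>m. f m v) x" for u v
      unfolding add twice_pd_lincomb(3)[OF assms(2) assms(2) assms(3)] by simp
    show "pdiff2 S i l (\<lambda>m. f m (r *\<^sub>R v)) x = r *\<^sub>R pdiff2 S i l (\<lambda>m. f m v) x" for r v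
      unfolding scale twice_pd_lincomb(3)[OF assms(2) assms(2) assms(3)] by simp
  qed
qed

lemma bilinear_pdiff:
  assumes b: "\<And>m. bilinear (b m)" and tw: "\<And>u v. twice_pd (\<lambda>m. b m u v)" and x: "x \<in> S"
  shows "bilinear (\<lambda>u v. pdiff S i (\<lambda>m. b m u v) x)"
    "bilinear (\<lambda>u v. pdiff2 S i l (\<lambda>m. b m u v) x)"
proof -
  have right: "linear (\<lambda>v. b m u v)" and left: "linear (\<lambda>u. b m u v)" for m u v
    using b by (simp_all add: bilinear_def)
  show "bilinear (\<lambda>u v. pdiff S i (\<lambda>m. b m u v) x)"
    unfolding bilinear_def
    by (intro conjI allI linear_pdiff(1)[OF right tw x] linear_pdiff(1)[OF left tw x])
  show "bilinear (\<lambda>u v. pdiff2 S i l (\<lambda>m. b m u v) x)"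
    unfolding bilinear_def
    by (intro conjI allI linear_pdiff(2)[OF right tw x] linear_pdiff(2)[OF left tw x])
qed

text \<open>The second rule differentiates in direction \<open>l\<close> a form already
  differentiated in direction \<open>i\<close>; the moving argument is differentiated just once, so
  first-order sensitivities suffice.\<close>

lemma has_pd_linear_family:
  fixes f :: "real^'p \<Rightarrow> 'v::real_inner \<Rightarrow> real"
  assumes fd: "\<exists>B. finite B \<and> H = span B"
    and f: "\<And>m. linear (f m)" "\<And>v. twice_pd (\<lambda>m. f m v)"
    and x: "x \<in> S"
    and v: "\<And>m. m \<in> S \<Longrightarrow> v m \<in> H" "v' \<in> H" "has_pd S l v v' x"
  shows "has_pd S l (\<lambda>m. f m (v m)) (pdiff S l (\<lambda>m. f m (v x)) x + f x v') x"
    and "has_pd S l (\<lambda>m. pdiff S i (\<lambda>m'. f m' (v m)) m)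
      (pdiff2 S i l (\<lambda>m. f m (v x)) x + pdiff S i (\<lambda>m. f m v') x) x"
proof -
  show "has_pd S l (\<lambda>m. f m (v m)) (pdiff S l (\<lambda>m. f m (v x)) x + f x v') x"
    by (rule has_pd_linear_form[OF fd x f(1) linear_pdiff(1)[OF f x] _ v])
      (rule twice_pd_has_pd(1)[OF f(2) x])
  show "has_pd S l (\<lambda>m. pdiff S i (\<lambda>m'. f m' (v m)) m)
      (pdiff2 S i l (\<lambda>m. f m (v x)) x + pdiff S i (\<lambda>m. f m v') x) x"
    by (rule has_pd_linear_form[OF fd x linear_pdiff(1)[OF f] linear_pdiff(2)[OF f x] _ v])
      (rule twice_pd_has_pd(2)[OF f(2) x] | assumption)+
qed

lemma has_pd_bilinear_family:
  fixes b :: "real^'p \<Rightarrow> 'v::real_inner \<Rightarrow> 'v \<Rightarrow> real"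
  assumes fd: "\<exists>B. finite B \<and> H = span B"
    and b: "\<And>m. bilinear (b m)" "\<And>u v. twice_pd (\<lambda>m. b m u v)"
    and x: "x \<in> S"
    and u: "\<And>m. m \<in> S \<Longrightarrow> u m \<in> H" "u' \<in> H" "has_pd S l u u' x"
    and v: "\<And>m. m \<in> S \<Longrightarrow> v m \<in> H" "v' \<in> H" "has_pd S l v v' x"
  shows "has_pd S l (\<lambda>m. b m (u m) (v m))
      (pdiff S l (\<lambda>m. b m (u x) (v x)) x + b x u' (v x) + b x (u x) v') x"
    and "has_pd S l (\<lambda>m. pdiff S i (\<lambda>m'. b m' (u m) (v m)) m)
      (pdiff2 S i l (\<lambda>m. b m (u x) (v x)) x + pdiff S i (\<lambda>m. b m u' (v x)) x
        + pdiff S i (\<lambda>m. b m (u x) v') x) x"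
proof -
  show "has_pd S l (\<lambda>m. b m (u m) (v m))
      (pdiff S l (\<lambda>m. b m (u x) (v x)) x + b x u' (v x) + b x (u x) v') x"
    by (rule has_pd_bilinear_form[OF fd x b(1) bilinear_pdiff(1)[OF b x] _ u v])
      (rule twice_pd_has_pd(1)[OF b(2) x])
  show "has_pd S l (\<lambda>m. pdiff S i (\<lambda>m'. b m' (u m) (v m)) m)
      (pdiff2 S i l (\<lambda>m. b m (u x) (v x)) x + pdiff S i (\<lambda>m. b m u' (v x)) x
        + pdiff S i (\<lambda>m. b m (u x) v') x) x"
    by (rule has_pd_bilinear_form[OF fd x bilinear_pdiff(1)[OF b] bilinear_pdiff(2)[OF b x] _ u v])
      (rule twice_pd_has_pd(2)[OF b(2) x] | assumption)+
qed

end

section \<open>The reduced model and its derivatives\<close>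

lemma params_eq_cbox: "params M = cbox (mu_a M) (mu_b M)"
  by (auto simp: params_def mem_box_cart)

text \<open>Packaged as a locale in order to be instantiated a second time, with the full order
  space in place of both reduced spaces.\<close>

locale reduced_model =
  fixes M :: "('v::real_inner, 'p::finite) problem"
  assumes box: "\<And>i. mu_a M $ i < mu_b M $ i"
    and Vh_finite_dim: "\<exists>B. finite B \<and> Vh M = span B"
    and Vpr_subspace: "subspace (Vpr M)" "Vpr M \<subseteq> Vh M"
    and Vdu_subspace: "subspace (Vdu M)" "Vdu M \<subseteq> Vh M"
    and a_coercive: "\<And>m. m \<in> params M \<Longrightarrow> coercive (\<lambda>u v. fa M m u v)"
    and k_symmetric: "\<And>m u v. m \<in> params M \<Longrightarrow> fk M m u v = fk M m v u"
    and a_C2: "C2_loc_Lipschitz_on (params M) (fa M)"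
    and l_C2: "C2_loc_Lipschitz_on (params M) (fl M)"
    and J_C2: "\<And>u. C2_loc_Lipschitz_on (params M) (objective M u)"
begin

sublocale param_box "params M" "mu_a M" "mu_b M"
  by standard (simp_all add: params_eq_cbox box)

abbreviation "\<d>a i m u v \<equiv> pdiff (params M) i (\<lambda>m. fa M m u v) m"
abbreviation "\<d>k i m u v \<equiv> pdiff (params M) i (\<lambda>m. fk M m u v) m"
abbreviation "\<d>l i m v \<equiv> pdiff (params M) i (\<lambda>m. fl M m v) m"
abbreviation "\<d>j i m v \<equiv> pdiff (params M) i (\<lambda>m. fj M m v) m"
abbreviation "\<d>\<d>a i l m u v \<equiv> pdiff2 (params M) i l (\<lambda>m. fa M m u v) m"
abbreviation "\<d>\<d>k i l m u v \<equiv> pdiff2 (params M) i l (\<lambda>m. fk M m u v) m"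
abbreviation "\<d>\<d>l i l m v \<equiv> pdiff2 (params M) i l (\<lambda>m. fl M m v) m"
abbreviation "\<d>\<d>j i l m v \<equiv> pdiff2 (params M) i l (\<lambda>m. fj M m v) m"

section \<open>Linearity and smoothness of the forms\<close>

lemma linear_l: "linear (\<lambda>v. fl M m v)" and linear_j: "linear (\<lambda>v. fj M m v)"
  by (auto intro!: linearI simp: blinfun.add_right blinfun.scaleR_right)

lemma bilinear_a: "bilinear (\<lambda>u v. fa M m u v)" and bilinear_k: "bilinear (\<lambda>u v. fk M m u v)"
  by (auto intro!: linearI simp: bilinear_def blinfun.bilinear_simps)

lemma twice_pd_a: "twice_pd (\<lambda>m. fa M m u v)"
  using C2_imp_twice_pd[OF a_C2, of "\<lambda>b. b u v"]
    bounded_linear_compose[OF blinfun.bounded_linear_left blinfun.bounded_linear_left]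
  by blast

lemma twice_pd_l: "twice_pd (\<lambda>m. fl M m v)"
  using C2_imp_twice_pd[OF l_C2 blinfun.bounded_linear_left] .

lemma twice_pd_objective: "twice_pd (objective M u)"
  using C2_imp_twice_pd[OF J_C2 bounded_linear_ident] .

lemma twice_pd_Theta: "twice_pd (Theta M)"
  using twice_pd_objective[of 0]
  by (rule twice_pd_cong) (simp add: objective_def blinfun.zero_right)

text \<open>Only the objective is assumed smooth; its parts odd and even in the state yield \<open>j\<close> and, by
  polarization, \<open>k\<close>.\<close>

lemma twice_pd_j: "twice_pd (\<lambda>m. fj M m v)"
  using twice_pd_lincomb(1)[OF twice_pd_objective[of v] twice_pd_objective[of "- v"], of "1/2" "-1/2"]
  by (rule twice_pd_cong) (simp add: objective_def blinfun.bilinear_simps field_simps)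

lemma twice_pd_k_diag: "twice_pd (\<lambda>m. fk M m v v)"
  using twice_pd_lincomb(1)[OF twice_pd_objective[of v]
      twice_pd_lincomb(1)[OF twice_pd_Theta twice_pd_j[of v], of 1 1], of 1 "-1"]
  by (rule twice_pd_cong) (simp add: objective_def)

lemma twice_pd_k: "twice_pd (\<lambda>m. fk M m u v)"
  using twice_pd_lincomb(1)[OF twice_pd_k_diag[of "u + v"]
      twice_pd_lincomb(1)[OF twice_pd_k_diag[of u] twice_pd_k_diag[of v], of 1 1], of "1/2" "-1/2"]
  by (rule twice_pd_cong) (simp add: blinfun.bilinear_simps k_symmetric[of _ v u] field_simps)

lemmas family_l = has_pd_linear_family[OF Vh_finite_dim linear_l twice_pd_l]
lemmas family_j = has_pd_linear_family[OF Vh_finite_dim linear_j twice_pd_j]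
lemmas family_a = has_pd_bilinear_family[OF Vh_finite_dim bilinear_a twice_pd_a]
lemmas family_k = has_pd_bilinear_family[OF Vh_finite_dim bilinear_k twice_pd_k]

lemmas linear_dl = linear_pdiff[OF linear_l twice_pd_l]
lemmas linear_dj = linear_pdiff[OF linear_j twice_pd_j]
lemmas bilinear_da = bilinear_pdiff[OF bilinear_a twice_pd_a]
lemmas bilinear_dk = bilinear_pdiff[OF bilinear_k twice_pd_k]

lemmas pd_l = twice_pd_has_pd(1)[OF twice_pd_l]
lemmas pd_j = twice_pd_has_pd(1)[OF twice_pd_j]
lemmas pd_a = twice_pd_has_pd(1)[OF twice_pd_a]
lemmas pd_k = twice_pd_has_pd(1)[OF twice_pd_k]

lemma pdiff_res_pr:
  "m \<in> params M \<Longrightarrow> pdiff (params M) i (\<lambda>m. res_pr M m u v) m = \<d>l i m v - \<d>a i m u v"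
  unfolding res_pr_def by (rule pdiff_eqI) (intro has_pd_diff pd_l pd_a)

lemma res_pr_d_eq:
  "m \<in> params M \<Longrightarrow> res_pr_d M i m u u' v = \<d>l i m v - \<d>a i m u v - fa M m u' v"
  by (simp add: res_pr_d_def pdiff_res_pr)

lemma pdiff_res_du:
  "m \<in> params M \<Longrightarrow> pdiff (params M) i (\<lambda>m. res_du M m u p v) m
     = \<d>j i m v + 2 * \<d>k i m v u - \<d>a i m v p"
  unfolding res_du_def
  by (rule pdiff_eqI) (intro has_pd_diff has_pd_add has_pd_cmult pd_j pd_a pd_k)

lemma res_du_d_eq:
  "m \<in> params M \<Longrightarrow> res_du_d M i m u p u' p' v
     = \<d>j i m v + 2 * \<d>k i m v u - \<d>a i m v p + 2 * fk M m v u' - fa M m v p'"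
  by (simp add: res_du_d_def pdiff_res_du)

lemma pdiff_z_rhs:
  "m \<in> params M \<Longrightarrow> pdiff (params M) i (\<lambda>m. res_pr M m u v + fa M m z v) m
     = \<d>l i m v - \<d>a i m u v + \<d>a i m z v"
  unfolding res_pr_def by (rule pdiff_eqI) (intro has_pd_diff has_pd_add pd_l pd_a)

lemma pdiff_w_rhs:
  "m \<in> params M \<Longrightarrow>
     pdiff (params M) i (\<lambda>m. res_du M m u p v - 2 * fk M m z v - fa M m v w) m
     = \<d>j i m v + 2 * \<d>k i m v u - \<d>a i m v p - 2 * \<d>k i m z v - \<d>a i m v w"
  unfolding res_du_def
  by (rule pdiff_eqI) (intro has_pd_diff has_pd_add has_pd_cmult pd_j pd_a pd_k)

lemma Vpr_finite_dim: "\<exists>B. finite B \<and> Vpr M = span B"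
  using Vh_finite_dim finite_dim_subspace_subset Vpr_subspace by metis

lemma Vdu_finite_dim: "\<exists>B. finite B \<and> Vdu M = span B"
  using Vh_finite_dim finite_dim_subspace_subset Vdu_subspace by metis

lemma a_coercive_const:
  assumes "m \<in> params M"
  obtains \<alpha> where "0 < \<alpha>" "\<And>v. \<alpha> * (norm v)\<^sup>2 \<le> fa M m v v"
  using a_coercive[OF assms] unfolding coercive_def by blast

lemma a_pos: "m \<in> params M \<Longrightarrow> v \<noteq> 0 \<Longrightarrow> 0 < fa M m v v"
  by (rule a_coercive_const[of m]) (assumption, smt (verit) mult_pos_pos zero_less_norm_iff zero_less_power)

lemmas form_linear = linear_lincomb linear_l linear_j linear_args[OF bilinear_a]
  linear_args[OF bilinear_k] linear_dl linear_dj bilinear_da[THEN linear_args(1)]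
  bilinear_da[THEN linear_args(2)] bilinear_dk[THEN linear_args(1)] bilinear_dk[THEN linear_args(2)]

section \<open>Galerkin equations of the reduced quantities\<close>

context
  fixes m assumes m: "m \<in> params M"
begin

lemma solution_a:
  assumes "\<exists>B. finite B \<and> W = span B" "linear F" "\<And>u v. E u v \<longleftrightarrow> fa M m u v = F v"
  shows "solution_in W E \<in> W" "v \<in> W \<Longrightarrow> fa M m (solution_in W E) v = F v"
  using solution_in_galerkin[OF assms(1) bilinear_a assms(2) a_pos[OF m], of E] assms(3) by auto

text \<open>\<open>fa\<close> need not be symmetric, and the equations of \<open>p_r\<close>,
  \<open>w_r\<close> and their sensitivities have the unknown in the second slot.\<close>

lemma solution_a_flip:
  assumes "\<exists>B. finite B \<and> W = span B" "linear F" "\<And>u v. E u v \<longleftrightarrow> fa M m v u = F v"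
  shows "solution_in W E \<in> W" "v \<in> W \<Longrightarrow> fa M m v (solution_in W E) = F v"
  using solution_in_galerkin[OF assms(1) bilinear_flip[OF bilinear_a] assms(2) a_pos[OF m], of E]
    assms(3) by auto

lemma u_r: "u_r M m \<in> Vpr M" "v \<in> Vpr M \<Longrightarrow> fa M m (u_r M m) v = fl M m v"
  unfolding u_r_def
  by (rule solution_a[OF Vpr_finite_dim, where F = "\<lambda>v. fl M m v"];
      auto simp: res_pr_def res_du_def res_pr_d_eq res_du_d_eq m intro!: form_linear)+

lemma p_r: "p_r M m \<in> Vdu M"
  "v \<in> Vdu M \<Longrightarrow> fa M m v (p_r M m) = fj M m v + 2 * fk M m v (u_r M m)"
  unfolding p_r_def
  by (rule solution_a_flip[OF Vdu_finite_dim, where F = "\<lambda>v. fj M m v + 2 * fk M m v (u_r M m)"];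
      auto simp: res_pr_def res_du_def res_pr_d_eq res_du_d_eq m intro!: form_linear)+

lemma z_r: "z_r M m \<in> Vdu M"
  "v \<in> Vdu M \<Longrightarrow> fa M m (z_r M m) v = fa M m (u_r M m) v - fl M m v"
  unfolding z_r_def
  by (rule solution_a[OF Vdu_finite_dim, where F = "\<lambda>v. fa M m (u_r M m) v - fl M m v"];
      auto simp: res_pr_def res_du_def res_pr_d_eq res_du_d_eq m intro!: form_linear)+

lemma w_r: "w_r M m \<in> Vpr M"
  "v \<in> Vpr M \<Longrightarrow> fa M m v (w_r M m)
     = fj M m v + 2 * fk M m v (u_r M m) - fa M m v (p_r M m) - 2 * fk M m (z_r M m) v"
  unfolding w_r_def
  by (rule solution_a_flip[OF Vpr_finite_dim,
      where F = "\<lambda>v. fj M m v + 2 * fk M m v (u_r M m) - fa M m v (p_r M m)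
        - 2 * fk M m (z_r M m) v"];
      auto simp: res_pr_def res_du_def res_pr_d_eq res_du_d_eq m intro!: form_linear)+

lemma d_u_r: "d_u_r M l m \<in> Vpr M"
  "v \<in> Vpr M \<Longrightarrow> fa M m (d_u_r M l m) v = \<d>l l m v - \<d>a l m (u_r M m) v"
  unfolding d_u_r_def
  by (rule solution_a[OF Vpr_finite_dim, where F = "\<lambda>v. \<d>l l m v - \<d>a l m (u_r M m) v"];
      auto simp: res_pr_def res_du_def res_pr_d_eq res_du_d_eq m intro!: form_linear)+

lemma d_p_r: "d_p_r M l m \<in> Vdu M"
  "v \<in> Vdu M \<Longrightarrow> fa M m v (d_p_r M l m)
     = \<d>j l m v + 2 * \<d>k l m v (u_r M m) - \<d>a l m v (p_r M m) + 2 * fk M m v (d_u_r M l m)"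
  unfolding d_p_r_def
  by (rule solution_a_flip[OF Vdu_finite_dim,
      where F = "\<lambda>v. \<d>j l m v + 2 * \<d>k l m v (u_r M m) - \<d>a l m v (p_r M m)
        + 2 * fk M m v (d_u_r M l m)"];
      auto simp: res_pr_def res_du_def res_pr_d_eq res_du_d_eq m intro!: form_linear)+

lemma d_z_r: "d_z_r M l m \<in> Vdu M"
  "v \<in> Vdu M \<Longrightarrow> fa M m (d_z_r M l m) v
     = - (\<d>l l m v - \<d>a l m (u_r M m) v + \<d>a l m (z_r M m) v) + fa M m (d_u_r M l m) v"
  unfolding d_z_r_def pdiff_z_rhs[OF m]
  by (rule solution_a[OF Vdu_finite_dim,
      where F = "\<lambda>v. - (\<d>l l m v - \<d>a l m (u_r M m) v + \<d>a l m (z_r M m) v)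
        + fa M m (d_u_r M l m) v"];
      auto simp: res_pr_def res_du_def res_pr_d_eq res_du_d_eq m intro!: form_linear)+

lemma d_w_r: "d_w_r M l m \<in> Vpr M"
  "v \<in> Vpr M \<Longrightarrow> fa M m v (d_w_r M l m)
     = \<d>j l m v + 2 * \<d>k l m v (u_r M m) - \<d>a l m v (p_r M m) - 2 * \<d>k l m (z_r M m) v
       - \<d>a l m v (w_r M m) + 2 * fk M m v (d_u_r M l m - d_z_r M l m) - fa M m v (d_p_r M l m)"
  unfolding d_w_r_def pdiff_w_rhs[OF m]
  by (rule solution_a_flip[OF Vpr_finite_dim,
      where F = "\<lambda>v. \<d>j l m v + 2 * \<d>k l m v (u_r M m) - \<d>a l m v (p_r M m)
        - 2 * \<d>k l m (z_r M m) v - \<d>a l m v (w_r M m)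
        + 2 * fk M m v (d_u_r M l m - d_z_r M l m) - fa M m v (d_p_r M l m)"];
      auto simp: res_pr_def res_du_def res_pr_d_eq res_du_d_eq m intro!: form_linear)+

end

lemma in_Vh: "v \<in> Vpr M \<Longrightarrow> v \<in> Vh M" "v \<in> Vdu M \<Longrightarrow> v \<in> Vh M"
  using Vpr_subspace Vdu_subspace by auto

lemmas in_Vh_r = u_r(1)[THEN in_Vh(1)] p_r(1)[THEN in_Vh(2)] z_r(1)[THEN in_Vh(2)] w_r(1)[THEN in_Vh(1)]
  d_u_r(1)[THEN in_Vh(1)] d_p_r(1)[THEN in_Vh(2)] d_z_r(1)[THEN in_Vh(2)] d_w_r(1)[THEN in_Vh(1)]

text \<open>The fixed argument is the test vector in equations whose right-hand sides depend on
  earlier solutions.\<close>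

lemmas family_k_right =
  has_pd_linear_family(1)[OF Vh_finite_dim linear_args(1)[OF bilinear_k] twice_pd_k]
lemmas family_k_left =
  has_pd_linear_family(1)[OF Vh_finite_dim linear_args(2)[OF bilinear_k] twice_pd_k]
lemmas family_a_right =
  has_pd_linear_family(1)[OF Vh_finite_dim linear_args(1)[OF bilinear_a] twice_pd_a]
lemmas family_a_left =
  has_pd_linear_family(1)[OF Vh_finite_dim linear_args(2)[OF bilinear_a] twice_pd_a]

section \<open>Sensitivities as derivatives of the solution maps\<close>

context
  fixes m assumes m: "m \<in> params M"
begin

text \<open>The defining equation of a sensitivity is the formal derivative of the equation of its
  solution, so it only has to be matched with the last hypothesis.\<close>

lemma solution_a_has_pd:
  assumes "\<exists>B. finite B \<and> W = span B"
    and "\<And>m. m \<in> params M \<Longrightarrow> linear (F m)" "linear F'"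
    and "\<And>v. has_pd (params M) i (\<lambda>m. F m v) (F' v) m"
    and "\<And>m. m \<in> params M \<Longrightarrow> y m \<in> W"
    and "\<And>m v. m \<in> params M \<Longrightarrow> v \<in> W \<Longrightarrow> fa M m (y m) v = F m v"
    and "y' \<in> W" "\<And>v. v \<in> W \<Longrightarrow> fa M m y' v = F' v - \<d>a i m (y m) v"
  shows "has_pd (params M) i y y' m"
proof -
  obtain \<alpha> where "0 < \<alpha>" "\<And>v. \<alpha> * (norm v)\<^sup>2 \<le> fa M m v v"
    using a_coercive_const[OF m] by blast
  then show ?thesis
    using galerkin_has_pd[OF assms(1) m bilinear_a assms(2) bilinear_da(1)[OF m] assms(3)
        pd_a[OF m] assms(4) _ _ assms(5-8)] by blast
qed

lemma solution_a_flip_has_pd: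
  assumes "\<exists>B. finite B \<and> W = span B"
    and "\<And>m. m \<in> params M \<Longrightarrow> linear (F m)" "linear F'"
    and "\<And>v. has_pd (params M) i (\<lambda>m. F m v) (F' v) m"
    and "\<And>m. m \<in> params M \<Longrightarrow> y m \<in> W"
    and "\<And>m v. m \<in> params M \<Longrightarrow> v \<in> W \<Longrightarrow> fa M m v (y m) = F m v"
    and "y' \<in> W" "\<And>v. v \<in> W \<Longrightarrow> fa M m v y' = F' v - \<d>a i m v (y m)"
  shows "has_pd (params M) i y y' m"
proof -
  obtain \<alpha> where "0 < \<alpha>" "\<And>v. \<alpha> * (norm v)\<^sup>2 \<le> fa M m v v"
    using a_coercive_const[OF m] by blast
  then show ?thesis
    using galerkin_has_pd[OF assms(1) m bilinear_flip[OF bilinear_a] assms(2)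
        bilinear_flip[OF bilinear_da(1)[OF m]] assms(3) pd_a[OF m] assms(4) _ _ assms(5-8)] by blast
qed

lemma has_pd_u_r: "has_pd (params M) l (u_r M) (d_u_r M l m) m"
  by (rule solution_a_has_pd[OF Vpr_finite_dim linear_l linear_dl(1)[OF m] pd_l[OF m]
        u_r d_u_r[OF m]])

text \<open>The right-hand side moves with \<open>u_r\<close>, whose derivative must be known first;
  the same kind of dependence orders the proofs for \<open>z_r\<close> and
  \<open>w_r\<close>.\<close>

lemma has_pd_p_r: "has_pd (params M) l (p_r M) (d_p_r M l m) m"
proof (rule solution_a_flip_has_pd[OF Vdu_finite_dim _ _ _ p_r d_p_r(1)[OF m]])
  show "has_pd (params M) l (\<lambda>m. fj M m v + 2 * fk M m v (u_r M m))
     (\<d>j l m v + 2 * (\<d>k l m v (u_r M m) + fk M m v (d_u_r M l m))) m" for v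
    by (intro has_pd_add has_pd_cmult pd_j m family_k_right has_pd_u_r in_Vh_r)
qed (use m d_p_r(2)[OF m] in \<open>auto intro!: form_linear\<close>)

lemma has_pd_z_r: "has_pd (params M) l (z_r M) (d_z_r M l m) m"
proof (rule solution_a_has_pd[OF Vdu_finite_dim _ _ _ z_r d_z_r(1)[OF m]])
  show "has_pd (params M) l (\<lambda>m. fa M m (u_r M m) v - fl M m v)
     (\<d>a l m (u_r M m) v + fa M m (d_u_r M l m) v - \<d>l l m v) m" for v
    by (intro has_pd_diff pd_l m family_a_left has_pd_u_r in_Vh_r)
qed (use m d_z_r(2)[OF m] in \<open>auto intro!: form_linear\<close>)

lemma has_pd_w_r: "has_pd (params M) l (w_r M) (d_w_r M l m) m"
proof (rule solution_a_flip_has_pd[OF Vpr_finite_dim _ _ _ w_r d_w_r(1)[OF m]])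
  show "has_pd (params M) l
      (\<lambda>m. fj M m v + 2 * fk M m v (u_r M m) - fa M m v (p_r M m) - 2 * fk M m (z_r M m) v)
      (\<d>j l m v + 2 * (\<d>k l m v (u_r M m) + fk M m v (d_u_r M l m))
        - (\<d>a l m v (p_r M m) + fa M m v (d_p_r M l m))
        - 2 * (\<d>k l m (z_r M m) v + fk M m (d_z_r M l m) v)) m" for v
    by (intro has_pd_diff has_pd_add has_pd_cmult pd_j m family_k_right family_k_left
        family_a_right has_pd_u_r has_pd_p_r has_pd_z_r in_Vh_r)
  show "fa M m v (d_w_r M l m)
      = \<d>j l m v + 2 * (\<d>k l m v (u_r M m) + fk M m v (d_u_r M l m))
        - (\<d>a l m v (p_r M m) + fa M m v (d_p_r M l m))
        - 2 * (\<d>k l m (z_r M m) v + fk M m (d_z_r M l m) v) - \<d>a l m v (w_r M m)"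
    if "v \<in> Vpr M" for v
    \<comment> \<open>The definition merges two sensitivities into one argument of
      \<open>fk\<close>; linearity separates them, and symmetry reconciles the slot of
      \<open>d_z_r\<close>.\<close>
    unfolding d_w_r(2)[OF m that]
    by (simp add: blinfun.diff_right k_symmetric[OF m, of "d_z_r M l m"] algebra_simps)
qed (use m in \<open>auto intro!: form_linear\<close>)

end

section \<open>Gradient and Hessian of the corrected functional\<close>

definition grad_r :: "'p \<Rightarrow> real^'p \<Rightarrow> real" where
  "grad_r i m = pdiff (params M) i (Theta M) m
     + \<d>j i m (u_r M m) + \<d>k i m (u_r M m) (u_r M m)
     + (\<d>l i m (p_r M m) - \<d>a i m (u_r M m) (p_r M m))
     + (\<d>l i m (w_r M m) - \<d>a i m (u_r M m) (w_r M m))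
     - (\<d>j i m (z_r M m) + 2 * \<d>k i m (z_r M m) (u_r M m) - \<d>a i m (z_r M m) (p_r M m))"

text \<open>Each bracket is the \<open>l\<close>-derivative of the corresponding bracket of
  \<open>grad_r\<close>, by the product rules for moving arguments.\<close>

definition hess_r :: "'p \<Rightarrow> 'p \<Rightarrow> real^'p \<Rightarrow> real" where
  "hess_r i l m =
    (let u = u_r M m; p = p_r M m; z = z_r M m; w = w_r M m;
       du = d_u_r M l m; dp = d_p_r M l m; dz = d_z_r M l m; dw = d_w_r M l m
     in pdiff2 (params M) i l (Theta M) m
       + (\<d>\<d>j i l m u + \<d>j i m du) + (\<d>\<d>k i l m u u + \<d>k i m du u + \<d>k i m u du)
       + (\<d>\<d>l i l m p + \<d>l i m dp - (\<d>\<d>a i l m u p + \<d>a i m du p + \<d>a i m u dp))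
       + (\<d>\<d>l i l m w + \<d>l i m dw - (\<d>\<d>a i l m u w + \<d>a i m du w + \<d>a i m u dw))
       - (\<d>\<d>j i l m z + \<d>j i m dz + 2 * (\<d>\<d>k i l m z u + \<d>k i m dz u + \<d>k i m z du)
          - (\<d>\<d>a i l m z p + \<d>a i m dz p + \<d>a i m z dp)))"

text \<open>Testing the equations of \<open>w\<close> and \<open>z\<close> with the sensitivities, and the sensitivity equations
  with \<open>w\<close> and \<open>z\<close>, eliminates the sensitivities from the gradient.\<close>

lemma J_r_has_pd:
  assumes m: "m \<in> params M"
  shows "has_pd (params M) i (J_r M) (grad_r i m) m"
proof -
  let ?u = "u_r M m" and ?p = "p_r M m" and ?z = "z_r M m" and ?w = "w_r M m"
    and ?du = "d_u_r M i m" and ?dp = "d_p_r M i m"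
  have "has_pd (params M) i
      (\<lambda>m. Theta M m + fj M m (u_r M m) + fk M m (u_r M m) (u_r M m)
        + (fl M m (p_r M m) - fa M m (u_r M m) (p_r M m)))
      (pdiff (params M) i (Theta M) m + (\<d>j i m ?u + fj M m ?du)
        + (\<d>k i m ?u ?u + fk M m ?du ?u + fk M m ?u ?du)
        + ((\<d>l i m ?p + fl M m ?dp) - (\<d>a i m ?u ?p + fa M m ?du ?p + fa M m ?u ?dp))) m"
    by (intro has_pd_add has_pd_diff twice_pd_has_pd twice_pd_Theta m family_j(1) family_k(1)
        family_l(1) family_a(1) has_pd_u_r has_pd_p_r in_Vh_r)
  also have "pdiff (params M) i (Theta M) m + (\<d>j i m ?u + fj M m ?du)
        + (\<d>k i m ?u ?u + fk M m ?du ?u + fk M m ?u ?du)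
        + ((\<d>l i m ?p + fl M m ?dp) - (\<d>a i m ?u ?p + fa M m ?du ?p + fa M m ?u ?dp)) = grad_r i m"
    using w_r(2)[OF m d_u_r(1)[OF m, of i]] d_u_r(2)[OF m w_r(1)[OF m], of i]
      z_r(2)[OF m d_p_r(1)[OF m, of i]] d_p_r(2)[OF m z_r(1)[OF m], of i]
      k_symmetric[OF m, of ?u ?du]
    unfolding grad_r_def by linarith
  finally show ?thesis
    by (simp add: J_r_def[abs_def] objective_def res_pr_def)
qed

lemma grad_r_has_pd:
  assumes m: "m \<in> params M"
  shows "has_pd (params M) l (grad_r i) (hess_r i l m) m"
  unfolding grad_r_def[abs_def] hess_r_def Let_def
  by (intro has_pd_add has_pd_diff has_pd_cmult twice_pd_has_pd(2) twice_pd_Theta m family_j(2)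
      family_k(2) family_l(2) family_a(2) has_pd_u_r has_pd_p_r has_pd_z_r has_pd_w_r in_Vh_r)

text \<open>Agreement on the box suffices because all derivatives are relative to it. This admits
  \<open>J_h\<close>, which coincides there with the corrected functional of the full order
  problem.\<close>

lemma hessian_eq_hess_r:
  assumes "m \<in> params M" "\<And>x. x \<in> params M \<Longrightarrow> f x = J_r M x"
  shows "hessian (params M) f m = (\<chi> i l. hess_r i l m)"
proof -
  have "has_pd (params M) i f (grad_r i x) x" if "x \<in> params M" for i x
    by (rule has_pd_transform[OF J_r_has_pd[OF that] that assms(2)])
  then have "pdiff2 (params M) i l f m = hess_r i l m" for i l
    using twice_pdI(3)[of f grad_r hess_r] grad_r_has_pd assms(1) by blast
  then show ?thesis by (simp add: hessian_def)
qed

end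

section \<open>Error bounds\<close>

lemma spectral_norm_mono:
  fixes A B :: "real^'p^'p"
  assumes "\<And>i l. \<bar>A $ i $ l\<bar> \<le> B $ i $ l"
  shows "spectral_norm A \<le> spectral_norm B"
  unfolding spectral_norm_def
proof (rule onorm_le)
  fix x :: "real^'p"
  \<comment> \<open>Componentwise absolute values preserve the Euclidean norm and exclude
    cancellation in the product with \<open>B\<close>.\<close>
  define y :: "real^'p" where "y = (\<chi> i. \<bar>x $ i\<bar>)"
  have "norm (A *v x) \<le> norm (B *v y)"
  proof (rule norm_le_componentwise_cart)
    fix i
    have "\<bar>(A *v x) $ i\<bar> \<le> (\<Sum>l\<in>UNIV. \<bar>A $ i $ l * x $ l\<bar>)"
      by (simp add: matrix_vector_mult_def)
    also have "\<dots> \<le> (\<Sum>l\<in>UNIV. B $ i $ l * y $ l)"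
      using assms by (intro sum_mono) (simp add: abs_mult y_def mult_right_mono)
    also have "\<dots> = (B *v y) $ i"
      by (simp add: matrix_vector_mult_def)
    finally show "norm ((A *v x) $ i) \<le> norm ((B *v y) $ i)"
      by simp
  qed
  also have "\<dots> \<le> onorm ((*v) B) * norm y"
    by (intro onorm) simp
  also have "norm y = norm x"
    by (simp add: norm_vec_def y_def)
  finally show "norm (A *v x) \<le> onorm ((*v) B) * norm x" .
qed

text \<open>The full order model is the reduced model with both reduced spaces equal to \<open>V\<^sub>h\<close>; its
  auxiliary functions vanish.\<close>

definition full_order :: "('v::real_normed_vector, 'p::finite) problem \<Rightarrow> ('v, 'p) problem" where
  "full_order M = M\<lparr>Vpr := Vh M, Vdu := Vh M\<rparr>"

lemma full_order_simps [simp]: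
  "Vh (full_order M) = Vh M" "Vpr (full_order M) = Vh M" "Vdu (full_order M) = Vh M"
  "mu_a (full_order M) = mu_a M" "mu_b (full_order M) = mu_b M"
  "fa (full_order M) = fa M" "fl (full_order M) = fl M" "fj (full_order M) = fj M"
  "fk (full_order M) = fk M" "Theta (full_order M) = Theta M"
  by (simp_all add: full_order_def)

lemma params_full_order [simp]: "params (full_order M) = params M"
  by (simp add: params_def)

lemma objective_full_order [simp]: "objective (full_order M) = objective M"
  by (simp add: objective_def[abs_def])

lemma u_h_eq: "u_h M m = u_r (full_order M) m"
  by (simp add: u_h_def u_r_def res_pr_def)

context reduced_model
begin

lemma Vh_subspace: "subspace (Vh M)"
  using Vh_finite_dim by auto

lemma full_order_reduced_model: "reduced_model (full_order M)"
  by standard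
    (use box Vh_finite_dim Vh_subspace a_coercive k_symmetric a_C2 l_C2 J_C2 in auto)

interpretation full: reduced_model "full_order M"
  by (rule full_order_reduced_model)

text \<open>The correction term vanishes because the full order adjoint is itself an admissible test
  vector for the primal equation.\<close>

lemma J_h_eq:
  assumes "m \<in> params M"
  shows "J_h M m = J_r (full_order M) m"
  using full.u_r(2)[of m "p_r (full_order M) m"] full.p_r(1)[of m] assms
  by (simp add: J_h_def J_r_def u_h_eq res_pr_def)

context
  fixes m assumes m: "m \<in> params M"
begin

text \<open>The right-hand side is a residual that vanishes on all of \<open>Vh M\<close>, so
  uniqueness gives zero. The next three proofs repeat this in an order that lets each use the
  earlier zeros.\<close>

lemma full_z_r: "z_r (full_order M) m = 0"
  using m full.z_r[of m] full.u_r(2)[of m] Vh_subspace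
  by (intro galerkin_unique[OF Vh_subspace bilinear_a a_pos[OF m], of _ 0])
    (auto simp: subspace_0)

lemma full_w_r: "w_r (full_order M) m = 0"
  using m full.w_r[of m] full.p_r(2)[of m] Vh_subspace
  by (intro galerkin_unique[OF Vh_subspace bilinear_flip[OF bilinear_a] a_pos[OF m], of _ 0])
    (auto simp: subspace_0 full_z_r)

lemma full_d_z_r: "d_z_r (full_order M) l m = 0"
  using m full.d_z_r[of m] full.d_u_r(2)[of m] Vh_subspace
  by (intro galerkin_unique[OF Vh_subspace bilinear_a a_pos[OF m], of _ 0])
    (auto simp: subspace_0 full_z_r)

lemma full_d_w_r: "d_w_r (full_order M) l m = 0"
  using m full.d_w_r[of m] full.d_p_r(2)[of m] Vh_subspace
  by (intro galerkin_unique[OF Vh_subspace bilinear_flip[OF bilinear_a] a_pos[OF m], of _ 0])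
    (auto simp: subspace_0 full_z_r full_w_r full_d_z_r)

section \<open>Continuity and residual bounds\<close>

lemma l_bounds:
  "v \<in> Vh M \<Longrightarrow> norm v \<le> B \<Longrightarrow> \<bar>\<d>l i m v\<bar> \<le> gam_d_l M i m * B"
  "v \<in> Vh M \<Longrightarrow> norm v \<le> B \<Longrightarrow> \<bar>\<d>\<d>l i l m v\<bar> \<le> gam_dd_l M i l m * B"
  unfolding gam_d_l_def gam_dd_l_def
  by (rule fun_norm_le[OF Vh_finite_dim linear_dl(1)[OF m]]
      fun_norm_le[OF Vh_finite_dim linear_dl(2)[OF m]];
      assumption)+

lemma j_bounds:
  "v \<in> Vh M \<Longrightarrow> norm v \<le> B \<Longrightarrow> \<bar>\<d>j i m v\<bar> \<le> gam_d_j M i m * B"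
  "v \<in> Vh M \<Longrightarrow> norm v \<le> B \<Longrightarrow> \<bar>\<d>\<d>j i l m v\<bar> \<le> gam_dd_j M i l m * B"
  unfolding gam_d_j_def gam_dd_j_def
  by (rule fun_norm_le[OF Vh_finite_dim linear_dj(1)[OF m]]
      fun_norm_le[OF Vh_finite_dim linear_dj(2)[OF m]];
      assumption)+

lemma a_bounds:
  "u \<in> Vh M \<Longrightarrow> v \<in> Vh M \<Longrightarrow> norm u \<le> A \<Longrightarrow> norm v \<le> B \<Longrightarrow>
     \<bar>\<d>a i m u v\<bar> \<le> gam_d_a M i m * (A * B)"
  "u \<in> Vh M \<Longrightarrow> v \<in> Vh M \<Longrightarrow> norm u \<le> A \<Longrightarrow> norm v \<le> B \<Longrightarrow>
     \<bar>\<d>\<d>a i l m u v\<bar> \<le> gam_dd_a M i l m * (A * B)"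
  unfolding gam_d_a_def gam_dd_a_def
  by (rule bil_norm_le[OF Vh_finite_dim bilinear_da(1)[OF m]]
      bil_norm_le[OF Vh_finite_dim bilinear_da(2)[OF m]];
      assumption)+

lemma k_bounds:
  "u \<in> Vh M \<Longrightarrow> v \<in> Vh M \<Longrightarrow> norm u \<le> A \<Longrightarrow> norm v \<le> B \<Longrightarrow>
     \<bar>fk M m u v\<bar> \<le> gam_k M m * (A * B)"
  "u \<in> Vh M \<Longrightarrow> v \<in> Vh M \<Longrightarrow> norm u \<le> A \<Longrightarrow> norm v \<le> B \<Longrightarrow>
     \<bar>\<d>k i m u v\<bar> \<le> gam_d_k M i m * (A * B)"
  "u \<in> Vh M \<Longrightarrow> v \<in> Vh M \<Longrightarrow> norm u \<le> A \<Longrightarrow> norm v \<le> B \<Longrightarrow>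
     \<bar>\<d>\<d>k i l m u v\<bar> \<le> gam_dd_k M i l m * (A * B)"
  unfolding gam_k_def gam_d_k_def gam_dd_k_def
  by (rule bil_norm_le[OF Vh_finite_dim bilinear_k] bil_norm_le[OF Vh_finite_dim bilinear_dk(1)[OF m]]
      bil_norm_le[OF Vh_finite_dim bilinear_dk(2)[OF m]]; assumption)+

lemma linear_res:
  "linear (res_pr M m u)" "linear (res_du M m u p)" "linear (res_pr_d M i m u u')"
  "linear (res_du_d M i m u p u' p')"
proof -
  show "linear (res_pr M m u)" "linear (res_du M m u p)"
    unfolding res_pr_def[abs_def] res_du_def[abs_def] by (intro form_linear m)+
  have "res_pr_d M i m u u' = (\<lambda>v. \<d>l i m v - \<d>a i m u v - fa M m u' v)"
    using res_pr_d_eq[OF m] by blast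
  then show "linear (res_pr_d M i m u u')"
    by (simp only:) (intro form_linear m)
  have "res_du_d M i m u p u' p'
      = (\<lambda>v. \<d>j i m v + 2 * \<d>k i m v u - \<d>a i m v p + 2 * fk M m v u' - fa M m v p')"
    using res_du_d_eq[OF m] by blast
  then show "linear (res_du_d M i m u p u' p')"
    by (simp only:) (intro form_linear m)
qed

lemma res_bounds:
  assumes "v \<in> Vh M"
  shows "\<bar>res_pr M m (u_r M m) v\<bar> \<le> norm_res_pr M m * norm v"
    and "\<bar>res_du M m (u_r M m) (p_r M m) v\<bar> \<le> norm_res_du M m * norm v"
    and "\<bar>res_pr_d M l m (u_r M m) (d_u_r M l m) v\<bar> \<le> norm_res_pr_d M l m * norm v"
    and "\<bar>res_du_d M l m (u_r M m) (p_r M m) (d_u_r M l m) (d_p_r M l m) v\<bar>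
      \<le> norm_res_du_d M l m * norm v"
  unfolding norm_res_pr_def norm_res_du_def norm_res_pr_d_def norm_res_du_d_def
  using fun_norm_bound[OF Vh_finite_dim linear_res(1) assms]
    fun_norm_bound[OF Vh_finite_dim linear_res(2) assms]
    fun_norm_bound[OF Vh_finite_dim linear_res(3) assms]
    fun_norm_bound[OF Vh_finite_dim linear_res(4) assms] by blast+

text \<open>One factor \<open>norm v\<close> cancels between coercivity and the upper bound; the
  last hypothesis serves a trivial \<open>Vh M\<close>.\<close>

lemma coer_a_bound:
  assumes "v \<in> Vh M" "fa M m v v \<le> N * norm v" "0 \<le> N" "Vh M = {0} \<Longrightarrow> N = 0"
  shows "norm v \<le> inverse (coer_a M m) * N"
proof (cases "Vh M = {0}")
  case True
  with assms show ?thesis by simp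
next
  case False
  then have "\<not> Vh M \<subseteq> {0}"
    using subspace_0[OF Vh_subspace] by auto
  obtain \<alpha> where "0 < \<alpha>" "\<And>v. \<alpha> * (norm v)\<^sup>2 \<le> fa M m v v"
    using a_coercive_const[OF m] by blast
  then have pos: "0 < coer_a M m" and "coer_a M m * (norm v)\<^sup>2 \<le> fa M m v v"
    unfolding coer_a_def
    using coercivity_const_pos[of \<alpha> "\<lambda>u v. fa M m u v"] coercivity_const_bound[of \<alpha> "\<lambda>u v. fa M m u v"]
      \<open>\<not> Vh M \<subseteq> {0}\<close> assms(1) by auto
  then have "coer_a M m * (norm v)\<^sup>2 \<le> N * norm v" using assms(2) by simp
  then have "v = 0 \<or> coer_a M m * norm v \<le> N"
    by (cases "v = 0") (simp_all add: power2_eq_square)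
  then show ?thesis
    using pos assms(3) by (auto simp: field_simps)
qed

text \<open>If \<open>V\<^sub>h\<close> is trivial, \<^const>\<open>coer_a\<close> is an infimum over the empty set, with unspecified
  value; the estimates then hold because every factor next to its inverse vanishes.\<close>

lemmas estimator_norm_defs = norm_res_pr_def norm_res_du_def norm_res_pr_d_def norm_res_du_d_def
  gam_k_def gam_d_a_def gam_d_k_def

lemma norms_trivial:
  assumes "Vh M = {0}"
  shows "norm_res_pr M m = 0" "norm_res_du M m = 0" "norm_res_pr_d M l m = 0"
    "norm_res_du_d M l m = 0" "gam_k M m = 0" "gam_d_a M l m = 0" "gam_d_k M l m = 0"
  by (simp_all add: assms estimator_norm_defs fun_norm_def bil_norm_def)

lemma estimators_trivial:
  assumes "Vh M = {0}"
  shows "Delta_pr M m = 0" "Delta_du M m = 0" "Delta_d_pr M l m = 0"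
  by (simp_all add: Delta_pr_def Delta_du_def Delta_d_pr_def norms_trivial[OF assms])

lemma norms_nonneg:
  "0 \<le> norm_res_pr M m" "0 \<le> norm_res_du M m" "0 \<le> norm_res_pr_d M l m" "0 \<le> norm_res_du_d M l m"
  "0 \<le> gam_k M m" "0 \<le> gam_d_a M l m" "0 \<le> gam_d_k M l m"
  unfolding estimator_norm_defs
  by (intro fun_norm_nonneg[OF Vh_finite_dim] linear_res bil_norm_nonneg[OF Vh_finite_dim]
      bilinear_k bilinear_da(1) bilinear_dk(1) m)+

section \<open>Norms of the auxiliary functions\<close>

lemma z_r_norm: "norm (z_r M m) \<le> inverse (coer_a M m) * norm_res_pr M m"
proof (rule coer_a_bound)
  show "fa M m (z_r M m) (z_r M m) \<le> norm_res_pr M m * norm (z_r M m)"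
    using z_r(2)[OF m z_r(1)[OF m]] res_bounds(1)[OF in_Vh_r(3)[OF m]]
    by (simp add: res_pr_def abs_le_iff)
qed (simp_all add: in_Vh_r m norms_nonneg norms_trivial)

lemma w_r_norm:
  "norm (w_r M m) \<le> inverse (coer_a M m) * (norm_res_du M m + 2 * gam_k M m * norm (z_r M m))"
proof (rule coer_a_bound)
  show "fa M m (w_r M m) (w_r M m) \<le> (norm_res_du M m + 2 * gam_k M m * norm (z_r M m)) * norm (w_r M m)"
    using w_r(2)[OF m w_r(1)[OF m]] res_bounds(2)[OF in_Vh_r(4)[OF m]]
      k_bounds(1)[OF in_Vh_r(3)[OF m] in_Vh_r(4)[OF m] order_refl order_refl]
    unfolding res_du_def abs_le_iff distrib_right by (simp add: mult.assoc)
qed (simp_all add: in_Vh_r m norms_nonneg norms_trivial)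

text \<open>Regrouped, the right-hand side of the equation is minus the residual of the primal
  sensitivity equation, minus the derivative of a at z. The test vector is the solution
  itself.\<close>

lemma d_z_r_norm:
  "norm (d_z_r M l m) \<le> inverse (coer_a M m) *
     (norm_res_pr_d M l m + gam_d_a M l m * norm (z_r M m))"
proof (rule coer_a_bound)
  show "fa M m (d_z_r M l m) (d_z_r M l m)
      \<le> (norm_res_pr_d M l m + gam_d_a M l m * norm (z_r M m)) * norm (d_z_r M l m)"
    using d_z_r(2)[OF m d_z_r(1)[OF m, of l], of l] res_bounds(3)[OF in_Vh_r(7)[OF m, of l], of l]
      a_bounds(1)[OF in_Vh_r(3)[OF m] in_Vh_r(7)[OF m, of l] order_refl order_refl, of l]
    unfolding res_pr_d_eq[OF m] abs_le_iff distrib_right by (simp add: mult.assoc)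
qed (simp_all add: in_Vh_r m norms_nonneg norms_trivial)

text \<open>Regrouped, the right-hand side is the residual of the adjoint sensitivity equation minus
  2 k(v, d_l z), 2 (d_l k)(z, v) and (d_l a)(v, w), one summand of the bound each.\<close>

lemma d_w_r_norm:
  "norm (d_w_r M l m) \<le> inverse (coer_a M m) *
     (norm_res_du_d M l m + 2 * gam_k M m * norm (d_z_r M l m)
      + 2 * gam_d_k M l m * norm (z_r M m) + gam_d_a M l m * norm (w_r M m))"
proof (rule coer_a_bound)
  show "fa M m (d_w_r M l m) (d_w_r M l m)
      \<le> (norm_res_du_d M l m + 2 * gam_k M m * norm (d_z_r M l m)
      + 2 * gam_d_k M l m * norm (z_r M m) + gam_d_a M l m * norm (w_r M m)) * norm (d_w_r M l m)"
    using d_w_r(2)[OF m d_w_r(1)[OF m, of l], of l] res_bounds(4)[OF in_Vh_r(8)[OF m, of l], of l]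
      a_bounds(1)[OF in_Vh_r(8)[OF m, of l] in_Vh_r(4)[OF m] order_refl order_refl, of l]
      k_bounds(1)[OF in_Vh_r(8)[OF m, of l] in_Vh_r(7)[OF m, of l] order_refl order_refl]
      k_bounds(2)[OF in_Vh_r(3)[OF m] in_Vh_r(8)[OF m, of l] order_refl order_refl, of l]
    unfolding res_du_d_eq[OF m] abs_le_iff distrib_right blinfun.diff_right
    by (simp add: mult.assoc mult.commute mult.left_commute)
qed (simp_all add: in_Vh_r m norms_nonneg norms_trivial)

section \<open>Errors of state, adjoint and sensitivities\<close>

abbreviation "e_u \<equiv> u_r (full_order M) m - u_r M m"
abbreviation "e_p \<equiv> p_r (full_order M) m - p_r M m"
abbreviation "e_du l \<equiv> d_u_r (full_order M) l m - d_u_r M l m"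
abbreviation "e_dp l \<equiv> d_p_r (full_order M) l m - d_p_r M l m"

lemma errors_in_Vh: "e_u \<in> Vh M" "e_p \<in> Vh M" "e_du l \<in> Vh M" "e_dp l \<in> Vh M"
  using full.in_Vh_r[of m] m by (auto intro!: subspace_diff[OF Vh_subspace] in_Vh_r)

text \<open>The full order equation holds on all of \<open>Vh M\<close>, so a(\<open>e_u\<close>, v)
  = r_pr(\<open>u_r\<close>)[v] there; the test vector is \<open>e_u\<close>.\<close>

lemma e_u_norm: "norm e_u \<le> Delta_pr M m"
  unfolding Delta_pr_def
proof (rule coer_a_bound)
  show "fa M m e_u e_u \<le> norm_res_pr M m * norm e_u"
    using full.u_r(2)[of m e_u] m errors_in_Vh(1) res_bounds(1)[OF errors_in_Vh(1)]
    by (simp add: res_pr_def blinfun.diff_left[of _ _ e_u] blinfun.diff_right[of "fa M m"] abs_le_iff)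
qed (simp_all add: errors_in_Vh norms_nonneg norms_trivial)

text \<open>Read off from the error bound, so that the sign of \<open>coer_a\<close>, unknown for
  trivial \<open>Vh M\<close>, does not enter.\<close>

lemma Delta_pr_nonneg: "0 \<le> Delta_pr M m"
  using e_u_norm norm_ge_zero order_trans by blast

lemma e_p_norm: "norm e_p \<le> Delta_du M m"
  unfolding Delta_du_def
proof (rule coer_a_bound)
  \<comment> \<open>The residual is formed at \<open>u_r\<close> instead of the full order state,
    which costs the extra term in \<open>fk\<close>.\<close>
  have "fa M m e_p e_p = res_du M m (u_r M m) (p_r M m) e_p + 2 * fk M m e_p e_u"
    using full.p_r(2)[of m e_p] m errors_in_Vh(2)
    by (simp add: res_du_def blinfun.diff_right[of "fa M m e_p"] blinfun.diff_right[of "fk M m e_p"])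
  then show "fa M m e_p e_p \<le> (2 * gam_k M m * Delta_pr M m + norm_res_du M m) * norm e_p"
    using res_bounds(2)[OF errors_in_Vh(2)]
      k_bounds(1)[OF errors_in_Vh(2,1) order_refl e_u_norm]
    unfolding abs_le_iff distrib_right by (simp add: mult.assoc mult.commute mult.left_commute)
qed (simp_all add: errors_in_Vh norms_nonneg Delta_pr_nonneg estimators_trivial norms_trivial)

lemma Delta_du_nonneg: "0 \<le> Delta_du M m"
  using e_p_norm norm_ge_zero order_trans by blast

text \<open>The two sensitivity equations are linearised at different states; the mismatch is the
  derivative of a applied to \<open>e_u\<close>, hence the \<open>gam_d_a\<close> term.\<close>

lemma e_du_norm: "norm (e_du l) \<le> Delta_d_pr M l m"
  unfolding Delta_d_pr_def
proof (rule coer_a_bound)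
  have "fa M m (e_du l) (e_du l)
      = res_pr_d M l m (u_r M m) (d_u_r M l m) (e_du l) - \<d>a l m e_u (e_du l)"
    using full.d_u_r(2)[of m "e_du l" l] m errors_in_Vh(3)
    by (simp add: res_pr_d_eq blinfun.diff_left[of _ _ "e_du l"] blinfun.diff_right[of "fa M m"]
        bilinear_lsub[OF bilinear_da(1)[OF m]])
  then show "fa M m (e_du l) (e_du l)
      \<le> (gam_d_a M l m * Delta_pr M m + norm_res_pr_d M l m) * norm (e_du l)"
    using res_bounds(3)[OF errors_in_Vh(3), of l l]
      a_bounds(1)[OF errors_in_Vh(1) errors_in_Vh(3)[of l] e_u_norm order_refl, of l]
    unfolding abs_le_iff distrib_right by (simp add: mult.assoc)
qed (simp_all add: errors_in_Vh norms_nonneg Delta_pr_nonneg estimators_trivial norms_trivial)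

lemma Delta_d_pr_nonneg: "0 \<le> Delta_d_pr M l m"
  using e_du_norm norm_ge_zero order_trans by blast

text \<open>Beside the residual there are mismatches in the state, the adjoint and the primal
  sensitivity; they account for the first three summands of the estimator.\<close>

lemma e_dp_norm: "norm (e_dp l) \<le> Delta_d_du M l m"
  unfolding Delta_d_du_def
proof (rule coer_a_bound)
  have "fa M m (e_dp l) (e_dp l)
      = res_du_d M l m (u_r M m) (p_r M m) (d_u_r M l m) (d_p_r M l m) (e_dp l)
        + 2 * \<d>k l m (e_dp l) e_u - \<d>a l m (e_dp l) e_p + 2 * fk M m (e_dp l) (e_du l)"
    using full.d_p_r(2)[of m "e_dp l" l] m errors_in_Vh(4)
    by (simp add: res_du_d_eq blinfun.diff_right[of "fa M m (e_dp l)"]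
        blinfun.diff_right[of "fk M m (e_dp l)"]
        bilinear_rsub[OF bilinear_da(1)[OF m]] bilinear_rsub[OF bilinear_dk(1)[OF m]])
  then show "fa M m (e_dp l) (e_dp l)
      \<le> (2 * gam_d_k M l m * Delta_pr M m + gam_d_a M l m * Delta_du M m
        + 2 * gam_k M m * Delta_d_pr M l m + norm_res_du_d M l m) * norm (e_dp l)"
    using res_bounds(4)[OF errors_in_Vh(4), of l l]
      k_bounds(2)[OF errors_in_Vh(4)[of l] errors_in_Vh(1) order_refl e_u_norm, of l]
      a_bounds(1)[OF errors_in_Vh(4)[of l] errors_in_Vh(2) order_refl e_p_norm, of l]
      k_bounds(1)[OF errors_in_Vh(4)[of l] errors_in_Vh(3)[of l] order_refl e_du_norm]
    unfolding abs_le_iff distrib_right by (simp add: mult.assoc mult.commute mult.left_commute)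
qed (simp_all add: errors_in_Vh norms_nonneg Delta_pr_nonneg Delta_du_nonneg Delta_d_pr_nonneg
    estimators_trivial norms_trivial)

section \<open>Difference of the Hessians\<close>

lemma hess_full:
  "full.hess_r i l m =
    (let u = u_r (full_order M) m; p = p_r (full_order M) m;
       du = d_u_r (full_order M) l m; dp = d_p_r (full_order M) l m
     in pdiff2 (params M) i l (Theta M) m
       + (\<d>\<d>j i l m u + \<d>j i m du) + (\<d>\<d>k i l m u u + \<d>k i m du u + \<d>k i m u du)
       + (\<d>\<d>l i l m p + \<d>l i m dp - (\<d>\<d>a i l m u p + \<d>a i m du p + \<d>a i m u dp)))"
  using m by (simp add: full.hess_r_def Let_def full_z_r full_w_r full_d_z_r full_d_w_r)

text \<open>Each bilinear difference splits as b(u + e, v + f) - b(u, v) = b(e, v) + b(u, f) + b(e,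
  f), and the last summand is the origin of the products of estimators. The \<Theta> terms cancel;
  those in z and w come from the reduced side alone.\<close>

lemma hess_diff:
  "full.hess_r i l m - hess_r i l m =
    (let u = u_r M m; p = p_r M m; z = z_r M m; w = w_r M m;
       du = d_u_r M l m; dp = d_p_r M l m; dz = d_z_r M l m; dw = d_w_r M l m
     in \<d>\<d>j i l m e_u + \<d>j i m (e_du l)
       + (\<d>\<d>k i l m e_u u + \<d>\<d>k i l m u e_u + \<d>\<d>k i l m e_u e_u)
       + (\<d>k i m (e_du l) u + \<d>k i m du e_u + \<d>k i m (e_du l) e_u)
       + (\<d>k i m u (e_du l) + \<d>k i m e_u du + \<d>k i m e_u (e_du l))
       + \<d>\<d>l i l m e_p + \<d>l i m (e_dp l)
       - (\<d>\<d>a i l m e_u p + \<d>\<d>a i l m u e_p + \<d>\<d>a i l m e_u e_p)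
       - (\<d>a i m (e_du l) p + \<d>a i m du e_p + \<d>a i m (e_du l) e_p)
       - (\<d>a i m e_u dp + \<d>a i m u (e_dp l) + \<d>a i m e_u (e_dp l))
       - (\<d>\<d>l i l m w + \<d>l i m dw - (\<d>\<d>a i l m u w + \<d>a i m du w + \<d>a i m u dw))
       + (\<d>\<d>j i l m z + \<d>j i m dz + 2 * (\<d>\<d>k i l m z u + \<d>k i m dz u + \<d>k i m z du)
          - (\<d>\<d>a i l m z p + \<d>a i m dz p + \<d>a i m z dp)))"
  unfolding hess_full hess_r_def Let_def
  by (simp add: linear_diff[OF linear_dl(1)[OF m]] linear_diff[OF linear_dl(2)[OF m]]
      linear_diff[OF linear_dj(1)[OF m]] linear_diff[OF linear_dj(2)[OF m]]
      bilinear_lsub[OF bilinear_da(1)[OF m]] bilinear_lsub[OF bilinear_da(2)[OF m]]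
      bilinear_rsub[OF bilinear_da(1)[OF m]] bilinear_rsub[OF bilinear_da(2)[OF m]]
      bilinear_lsub[OF bilinear_dk(1)[OF m]] bilinear_lsub[OF bilinear_dk(2)[OF m]]
      bilinear_rsub[OF bilinear_dk(1)[OF m]] bilinear_rsub[OF bilinear_dk(2)[OF m]])

lemma hess_diff_bound: "\<bar>full.hess_r i l m - hess_r i l m\<bar> \<le> Delta_H_entry M i l m"
proof -
  let ?u = "u_r M m" and ?p = "p_r M m" and ?z = "z_r M m" and ?w = "w_r M m"
    and ?du = "d_u_r M l m" and ?dp = "d_p_r M l m" and ?dz = "d_z_r M l m" and ?dw = "d_w_r M l m"
  let ?Dpr = "Delta_pr M m" and ?Ddu = "Delta_du M m"
    and ?Ddpr = "Delta_d_pr M l m" and ?Dddu = "Delta_d_du M l m"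
  let ?ga = "\<lambda>x y. gam_d_a M i m * (x * y)" and ?gk = "\<lambda>x y. gam_d_k M i m * (x * y)"
    and ?gl = "\<lambda>x. gam_d_l M i m * x" and ?gj = "\<lambda>x. gam_d_j M i m * x"
    and ?gga = "\<lambda>x y. gam_dd_a M i l m * (x * y)" and ?ggk = "\<lambda>x y. gam_dd_k M i l m * (x * y)"
    and ?ggl = "\<lambda>x. gam_dd_l M i l m * x" and ?ggj = "\<lambda>x. gam_dd_j M i l m * x"
  note V = in_Vh_r(1,2,3,4)[OF m] in_Vh_r(5,6,7,8)[OF m, of l] errors_in_Vh(1,2) errors_in_Vh(3,4)[of l]
  note n = e_u_norm e_p_norm e_du_norm[of l] e_dp_norm[of l] order_refl
  have add: "\<bar>x + y\<bar> \<le> A + B" and diff: "\<bar>x - y\<bar> \<le> A + B"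
    if "\<bar>x\<bar> \<le> A" "\<bar>y\<bar> \<le> B" for x y A B :: real
    using that by linarith+
  have double: "\<bar>2 * x\<bar> \<le> 2 * A" if "\<bar>x\<bar> \<le> A" for x A :: real
    using that by linarith
  have lj: "\<bar>\<d>\<d>j i l m e_u\<bar> \<le> ?ggj ?Dpr" "\<bar>\<d>j i m (e_du l)\<bar> \<le> ?gj ?Ddpr"
    "\<bar>\<d>\<d>j i l m ?z\<bar> \<le> ?ggj (norm ?z)" "\<bar>\<d>j i m ?dz\<bar> \<le> ?gj (norm ?dz)"
    "\<bar>\<d>\<d>l i l m e_p\<bar> \<le> ?ggl ?Ddu" "\<bar>\<d>l i m (e_dp l)\<bar> \<le> ?gl ?Dddu"
    "\<bar>\<d>\<d>l i l m ?w\<bar> \<le> ?ggl (norm ?w)" "\<bar>\<d>l i m ?dw\<bar> \<le> ?gl (norm ?dw)"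
    by (intro l_bounds j_bounds V n)+
  have k: "\<bar>\<d>\<d>k i l m e_u ?u\<bar> \<le> ?ggk ?Dpr (norm ?u)" "\<bar>\<d>\<d>k i l m ?u e_u\<bar> \<le> ?ggk (norm ?u) ?Dpr"
    "\<bar>\<d>\<d>k i l m e_u e_u\<bar> \<le> ?ggk ?Dpr ?Dpr" "\<bar>\<d>\<d>k i l m ?z ?u\<bar> \<le> ?ggk (norm ?z) (norm ?u)"
    "\<bar>\<d>k i m (e_du l) ?u\<bar> \<le> ?gk ?Ddpr (norm ?u)" "\<bar>\<d>k i m ?u (e_du l)\<bar> \<le> ?gk (norm ?u) ?Ddpr"
    "\<bar>\<d>k i m ?du e_u\<bar> \<le> ?gk (norm ?du) ?Dpr" "\<bar>\<d>k i m e_u ?du\<bar> \<le> ?gk ?Dpr (norm ?du)"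
    "\<bar>\<d>k i m (e_du l) e_u\<bar> \<le> ?gk ?Ddpr ?Dpr" "\<bar>\<d>k i m e_u (e_du l)\<bar> \<le> ?gk ?Dpr ?Ddpr"
    "\<bar>\<d>k i m ?dz ?u\<bar> \<le> ?gk (norm ?dz) (norm ?u)" "\<bar>\<d>k i m ?z ?du\<bar> \<le> ?gk (norm ?z) (norm ?du)"
    by (intro k_bounds V n)+
  have a: "\<bar>\<d>\<d>a i l m e_u ?p\<bar> \<le> ?gga ?Dpr (norm ?p)" "\<bar>\<d>\<d>a i l m ?u e_p\<bar> \<le> ?gga (norm ?u) ?Ddu"
    "\<bar>\<d>\<d>a i l m e_u e_p\<bar> \<le> ?gga ?Dpr ?Ddu"
    "\<bar>\<d>\<d>a i l m ?u ?w\<bar> \<le> ?gga (norm ?u) (norm ?w)" "\<bar>\<d>\<d>a i l m ?z ?p\<bar> \<le> ?gga (norm ?z) (norm ?p)"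
    "\<bar>\<d>a i m (e_du l) ?p\<bar> \<le> ?ga ?Ddpr (norm ?p)" "\<bar>\<d>a i m ?du e_p\<bar> \<le> ?ga (norm ?du) ?Ddu"
    "\<bar>\<d>a i m (e_du l) e_p\<bar> \<le> ?ga ?Ddpr ?Ddu"
    "\<bar>\<d>a i m e_u ?dp\<bar> \<le> ?ga ?Dpr (norm ?dp)" "\<bar>\<d>a i m ?u (e_dp l)\<bar> \<le> ?ga (norm ?u) ?Dddu"
    "\<bar>\<d>a i m e_u (e_dp l)\<bar> \<le> ?ga ?Dpr ?Dddu"
    "\<bar>\<d>a i m ?du ?w\<bar> \<le> ?ga (norm ?du) (norm ?w)" "\<bar>\<d>a i m ?u ?dw\<bar> \<le> ?ga (norm ?u) (norm ?dw)"
    "\<bar>\<d>a i m ?dz ?p\<bar> \<le> ?ga (norm ?dz) (norm ?p)" "\<bar>\<d>a i m ?z ?dp\<bar> \<le> ?ga (norm ?z) (norm ?dp)"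
    by (intro a_bounds V n)+
  \<comment> \<open>The bound copies the bracketing of \<open>hess_diff\<close> with every minus
    turned into plus, so \<open>add\<close>, \<open>diff\<close> and \<open>double\<close> can
    follow the term structure.\<close>
  have "\<bar>full.hess_r i l m - hess_r i l m\<bar> \<le>
      ?ggj ?Dpr + ?gj ?Ddpr
      + (?ggk ?Dpr (norm ?u) + ?ggk (norm ?u) ?Dpr + ?ggk ?Dpr ?Dpr)
      + (?gk ?Ddpr (norm ?u) + ?gk (norm ?du) ?Dpr + ?gk ?Ddpr ?Dpr)
      + (?gk (norm ?u) ?Ddpr + ?gk ?Dpr (norm ?du) + ?gk ?Dpr ?Ddpr)
      + ?ggl ?Ddu + ?gl ?Dddu
      + (?gga ?Dpr (norm ?p) + ?gga (norm ?u) ?Ddu + ?gga ?Dpr ?Ddu)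
      + (?ga ?Ddpr (norm ?p) + ?ga (norm ?du) ?Ddu + ?ga ?Ddpr ?Ddu)
      + (?ga ?Dpr (norm ?dp) + ?ga (norm ?u) ?Dddu + ?ga ?Dpr ?Dddu)
      + (?ggl (norm ?w) + ?gl (norm ?dw)
        + (?gga (norm ?u) (norm ?w) + ?ga (norm ?du) (norm ?w) + ?ga (norm ?u) (norm ?dw)))
      + (?ggj (norm ?z) + ?gj (norm ?dz)
        + 2 * (?ggk (norm ?z) (norm ?u) + ?gk (norm ?dz) (norm ?u) + ?gk (norm ?z) (norm ?du))
        + (?gga (norm ?z) (norm ?p) + ?ga (norm ?dz) (norm ?p) + ?ga (norm ?z) (norm ?dp)))"
    unfolding hess_diff Let_def by (intro add diff double lj k a)
  \<comment> \<open>Terms in k with their arguments exchanged were bounded separately by equal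
    amounts; adding these yields the factors 2 at the error terms.\<close>
  also have "\<dots> = Delta_H_entry M i l m"
    unfolding Delta_H_entry_def Let_def by (simp add: algebra_simps power2_eq_square)
  finally show ?thesis .
qed

lemma hessian_error:
  "spectral_norm (hessian (params M) (J_h M) m - hessian (params M) (J_r M) m) \<le> Delta_H M m"
proof -
  have "hessian (params M) (J_h M) m = (\<chi> i l. full.hess_r i l m)"
    using full.hessian_eq_hess_r[of m "J_h M"] m J_h_eq by simp
  moreover have "hessian (params M) (J_r M) m = (\<chi> i l. hess_r i l m)"
    by (rule hessian_eq_hess_r[OF m refl])
  ultimately show ?thesis
    unfolding Delta_H_def by (intro spectral_norm_mono) (simp add: hess_diff_bound)
qed

end

end

theorem proposition2p6:
  fixes M :: "('v::{real_inner, complete_space}, 'p::finite) problem"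
    and \<mu> :: "real^'p"
  assumes box: "\<And>i. mu_a M $ i < mu_b M $ i"
    and Vh_subspace: "subspace (Vh M)"
    and Vh_finite_dim: "\<exists>B. finite B \<and> Vh M = span B"
    and Vpr_subspace: "subspace (Vpr M)" "Vpr M \<subseteq> Vh M"
    and Vdu_subspace: "subspace (Vdu M)" "Vdu M \<subseteq> Vh M"
    and a_coercive: "\<And>m. m \<in> params M \<Longrightarrow> coercive (\<lambda>u v. fa M m u v)"
    and k_symmetric: "\<And>m u v. m \<in> params M \<Longrightarrow> fk M m u v = fk M m v u"
    and separable: "param_separable (params M) (fa M)" "param_separable (params M) (fl M)"
      "param_separable (params M) (fj M)" "param_separable (params M) (fk M)"
    and a_C2: "C2_loc_Lipschitz_on (params M) (fa M)"
    and l_C2: "C2_loc_Lipschitz_on (params M) (fl M)"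
    and J_C2: "\<And>u. C2_loc_Lipschitz_on (params M) (objective M u)"
    and \<mu>: "\<mu> \<in> params M"
  shows "spectral_norm (hessian (params M) (J_h M) \<mu> - hessian (params M) (J_r M) \<mu>)
           \<le> Delta_H M \<mu>
    \<and> norm (z_r M \<mu>) \<le> inverse (coer_a M \<mu>) * norm_res_pr M \<mu>
    \<and> norm (w_r M \<mu>) \<le> inverse (coer_a M \<mu>) *
         (norm_res_du M \<mu> + 2 * gam_k M \<mu> * norm (z_r M \<mu>))
    \<and> (\<forall>l. norm (d_z_r M l \<mu>) \<le> inverse (coer_a M \<mu>) *
         (norm_res_pr_d M l \<mu> + gam_d_a M l \<mu> * norm (z_r M \<mu>)))
    \<and> (\<forall>l. norm (d_w_r M l \<mu>) \<le> inverse (coer_a M \<mu>) *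
         (norm_res_du_d M l \<mu> + 2 * gam_k M \<mu> * norm (d_z_r M l \<mu>)
          + 2 * gam_d_k M l \<mu> * norm (z_r M \<mu>) + gam_d_a M l \<mu> * norm (w_r M \<mu>)))"
proof -
  interpret reduced_model M
    by standard (fact box Vh_finite_dim Vpr_subspace Vdu_subspace a_coercive k_symmetric
        a_C2 l_C2 J_C2)+
  show ?thesis
    using hessian_error[OF \<mu>] z_r_norm[OF \<mu>] w_r_norm[OF \<mu>] d_z_r_norm[OF \<mu>] d_w_r_norm[OF \<mu>]
    by blast
qed

end
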